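(* Let $C_m=\frac{1}{m+1}\binom{2m}{m}$ denote the $m$-th Catalan number. Label the vertices of a regular convex $N$-gon by $0,1,\ldots,N-1$ in cyclic order, and for vertices $x\neq y$ and an integer $k\ge 0$ let $f_{xy}(N,k)$ denote the number of triangulations of this $N$-gon containing exactly $k$ diagonals parallel to the segment $xy$. In the sums below, $(i_1,\ldots,i_{k+1})$ ranges over all tuples of positive integers with the indicated sum. (i) If $n\ge 2$ and $k\ge 1$, then \[f_{01}(2n,k)=\sum_{i_1+\cdots+i_{k+1}=n-1} 2^{k+1}C_{2i_1-1}C_{2i_2-1}\cdots C_{2i_{k+1}-1}.\] (ii) If $n\ge 2$ and $k\ge 1$, then \[f_{02}(2n,k)=\sum_{i_1+\cdots+i_{k+1}=n} 2^{k-1}\bigl(2^{2i_1-1}C_{i_1-1}-C_{2i_1-1}\bigr)\bigl(2^{2i_2-1}C_{i_2-1}-C_{2i_2-1}\bigr)C_{2i_3-1}C_{2i_4-1}\cdots C_{2i_{k+1}-1}.\] (iii) If $n\ge 1$ and $k\ge 1$, then \[f_{01}(2n+1,k)=\sum_{i_1+\cdots+i_{k+1}=n} 2^{k}\bigl(2^{2i_1-1}C_{i_1-1}-C_{2i_1-1}\bigr)C_{2i_2-1}C_{2i_3-1}\cdots C_{2i_{k+1}-1}.\]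
   Context: A triangulation of a convex $N$-gon is a maximal set of pairwise non-crossing diagonals (there are $N-3$ of them), viewed as a graph on the vertices $0,\ldots,N-1$ whose edges are the sides $01,12,\ldots,(N-1)0$ together with these diagonals. Here $xy$ may be a side (e.g. $01$) or a diagonal (e.g. $02$) of the regular polygon, and "parallel" means parallel as line segments in the regular $N$-gon (equivalently, $ab$ is parallel to $cd$ iff $a+b\equiv c+d\pmod N$). Empty products (e.g. $C_{2i_3-1}\cdots C_{2i_{k+1}-1}$ when $k=1$) equal $1$. *)

theory Defs
  imports Main
begin

definition catalan :: "nat \<Rightarrow> int" where
  "catalan m = int (((2*m) choose m) div (m+1))"

definition is_diag :: "nat \<Rightarrow> nat \<times> nat \<Rightarrow> bool" where
  "is_diag N p \<longleftrightarrow> (case p of (a,b) \<Rightarrow>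
      a < b \<and> b < N \<and> b - a \<ge> 2 \<and> \<not> (a = 0 \<and> b = N - 1))"

definition crosses :: "nat \<times> nat \<Rightarrow> nat \<times> nat \<Rightarrow> bool" where
  "crosses p q \<longleftrightarrow> (case p of (a,b) \<Rightarrow> case q of (c,d) \<Rightarrow>
      (a < c \<and> c < b \<and> b < d) \<or> (c < a \<and> a < d \<and> d < b))"

definition triangulation :: "nat \<Rightarrow> (nat \<times> nat) set \<Rightarrow> bool" where
  "triangulation N T \<longleftrightarrow>
     T \<subseteq> {p. is_diag N p} \<and>
     (\<forall>p\<in>T. \<forall>q\<in>T. \<not> crosses p q) \<and>
     (\<forall>q. is_diag N q \<and> q \<notin> T \<longrightarrow> (\<exists>p\<in>T. crosses p q))"

text \<open>ab is parallel to xy in the regular N-gon iff a+b = x+y (mod N).\<close>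
definition parallel :: "nat \<Rightarrow> nat \<Rightarrow> nat \<Rightarrow> nat \<times> nat \<Rightarrow> bool" where
  "parallel N x y p \<longleftrightarrow> (case p of (a,b) \<Rightarrow> (a + b) mod N = (x + y) mod N)"

definition f :: "nat \<Rightarrow> nat \<Rightarrow> nat \<Rightarrow> nat \<Rightarrow> nat" where
  "f x y N k = card {T. triangulation N T \<and> card {p\<in>T. parallel N x y p} = k}"

definition comps :: "nat \<Rightarrow> nat \<Rightarrow> nat list set" where
  "comps len s = {is. length is = len \<and> (\<forall>i\<in>set is. i > 0) \<and> sum_list is = s}"

definition g :: "nat \<Rightarrow> int" where
  "g i = 2 ^ (2*i - 1) * catalan (i - 1) - catalan (2*i - 1)"

definition codd :: "nat \<Rightarrow> int" where
  "codd i = catalan (2*i - 1)"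

end

theory Submission
  imports Defs "HOL-Computational_Algebra.Formal_Power_Series"
begin

text \<open>
  The \<open>k\<close> diagonals of a triangulation that are parallel to a given segment cut the polygon into
  \<open>k + 1\<close> pieces: trapezoidal pieces lying between two parallel chords, and caps with a single
  vertex at the tip, whose triangulations contain no further parallel diagonal. Hence the counts
  are coefficients of products of two power series, \<open>H\<close> for the trapezoids and \<open>E\<close> for the caps.
  Applying the same decomposition to all triangulations gives \<open>A (1 - H) = 1\<close> and
  \<open>E = B (1 - H)\<close>, where \<open>A\<close> has coefficients \<open>C\<^sub>2\<^sub>m\<close> and \<open>B\<close> has coefficients
  \<open>C\<close> at \<open>2 m - 1\<close>. The even and odd parts of the Catalan recurrence give \<open>A = 1 + 2 A B\<close> and
  \<open>B = x A\<^sup>2 + B\<^sup>2\<close>, so \<open>H = 2 B\<close> and \<open>E = B - 2 B\<^sup>2 = 2 x A\<^sup>2 - B\<close>. Finally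
  \<open>A\<^sup>2\<close> solves \<open>y = 1 + 4 x y\<^sup>2\<close>, so its coefficients are \<open>4\<^sup>m C\<^sub>m\<close>.
\<close>

section \<open>Catalan numbers\<close>

text \<open>Cutting leaves polygons whose labels need not form an interval, so a polygon is taken to
  be any finite set of labels in increasing order. The congruence that defines parallelism is
  replaced by an exact equation: the labels are rotated into a window in which the class consists of
  the chords with label sum \<open>s\<close>. These chords, the rungs, are nested, and the
  reflection x -> s - x exchanges the two ends of each. Parallel sides of the polygon count as rungs
  too. The pieces of a cut are then of the same kind as the whole, and the number of rungs differs
  from the number of parallel diagonals by a constant.

  The series H is not found by counting inside a trapezoid. Sorting all triangulations by their
  second rung leaves the newest coefficient of H as the only unknown, and E then follows from the
  total for odd polygons. The class of 02 in an even polygon has a tip at both ends. One tip has no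
  mirror image in the window, so its cap must be rotated once more before the count of caps applies
  to it.\<close>

fun cat :: "nat \<Rightarrow> nat" where
  "cat 0 = 1"
| "cat (Suc n) = (\<Sum>i\<le>n. cat i * cat (n - i))"

declare cat.simps(2) [simp del]

definition cat_fps :: "int fps" where
  "cat_fps = Abs_fps (\<lambda>n. int (cat n))"

lemma cat_fps_eq: "cat_fps = 1 + fps_X * (cat_fps * cat_fps)"
proof (rule fps_ext)
  fix n
  have "fps_nth (cat_fps * cat_fps) m = int (cat (Suc m))" for m
    by (simp add: fps_mult_nth cat_fps_def cat.simps(2) atLeast0AtMost)
  then show "fps_nth cat_fps n = fps_nth (1 + fps_X * (cat_fps * cat_fps)) n"
    by (cases n) (simp_all add: cat_fps_def)
qed

text \<open>Differentiating the quadratic equation and eliminating its square root \<open>1 - 2 x c\<close>.\<close>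
lemma cat_fps_deriv:
  "fps_X * ((1 - 4 * fps_X) * fps_deriv cat_fps) = 1 - cat_fps + 2 * (fps_X * cat_fps)"
proof -
  define F X F' where "F = cat_fps" and "X = (fps_X :: int fps)" and "F' = fps_deriv cat_fps"
  have q: "X * (F * F) = F - 1"
    using arg_cong[OF cat_fps_eq, of "\<lambda>z. z - 1"] by (simp add: F_def X_def)
  have "F' = fps_deriv (1 + fps_X * (cat_fps * cat_fps))"
    unfolding F'_def by (rule arg_cong[OF cat_fps_eq])
  then have d: "F' * (1 - 2 * (X * F)) = F * F"
    by (simp add: F_def X_def F'_def algebra_simps)
  have "(1 - 2 * (X * F)) * (1 - 2 * (X * F)) = 1 - 4 * (X * F) + 4 * X * (X * (F * F))"
    by (simp add: algebra_simps)
  also have "\<dots> = 1 - 4 * X"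
    unfolding q by (simp add: algebra_simps)
  finally have sq: "(1 - 2 * (X * F)) * (1 - 2 * (X * F)) = 1 - 4 * X" .
  have "X * ((1 - 4 * X) * F') = X * (F' * (1 - 2 * (X * F))) * (1 - 2 * (X * F))"
    unfolding sq[symmetric] by (simp only: mult_ac)
  also have "\<dots> = (F - 1) * (1 - 2 * (X * F))"
    unfolding d q ..
  also have "\<dots> = F - 1 - 2 * (X * (F * F)) + 2 * (X * F)"
    by (simp add: algebra_simps)
  also have "\<dots> = 1 - F + 2 * (X * F)"
    unfolding q by simp
  finally show ?thesis by (simp only: F_def X_def F'_def)
qed

text \<open>Comparing coefficients in the differential equation turns the quadratic convolution into
  a two-term recurrence, which can be matched with binomial coefficients.\<close>

lemma cat_rec: "(n + 2) * cat (Suc n) = (4 * n + 2) * cat n"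
proof -
  have "fps_nth (fps_X * ((1 - 4 * fps_X) * fps_deriv cat_fps)) (Suc n)
      = fps_nth (1 - cat_fps + 2 * (fps_X * cat_fps)) (Suc n)"
    by (simp only: cat_fps_deriv)
  moreover have "fps_nth (fps_X * ((1 - 4 * fps_X) * fps_deriv cat_fps)) (Suc n)
      = (int n + 1) * int (cat (Suc n)) - 4 * int n * int (cat n)"
  proof -
    have "(1 - 4 * fps_X) * fps_deriv cat_fps = fps_deriv cat_fps - 4 * (fps_X * fps_deriv cat_fps)"
      by (simp add: algebra_simps)
    then show ?thesis
      by (cases n) (simp_all add: cat_fps_def numeral_fps_const)
  qed
  moreover have "fps_nth (1 - cat_fps + 2 * (fps_X * cat_fps)) (Suc n)
      = 2 * int (cat n) - int (cat (Suc n))"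
    by (simp add: cat_fps_def numeral_fps_const)
  ultimately have "int ((n + 2) * cat (Suc n)) = int ((4 * n + 2) * cat n)"
    by (simp add: algebra_simps)
  then show ?thesis by (simp only: of_nat_eq_iff)
qed

text \<open>One central binomial coefficient leads to the next by two absorption steps through
  \<open>Suc (2 * n) choose n\<close>; the resulting ratio matches \<open>cat_rec\<close>.\<close>

lemma cat_binomial: "(n + 1) * cat n = (2 * n) choose n"
proof (induction n)
  case (Suc n)
  define x y z where "x = (2 * Suc n) choose Suc n" and "y = Suc (2 * n) choose n"
    and "z = (2 * n) choose n"
  have xy: "(2 * n + 2) * y = x * (n + 1)"
    using Suc_times_binomial_eq[of "Suc (2 * n)" n] by (simp add: x_def y_def del: binomial_Suc_Suc)
  have "y = Suc (2 * n) choose Suc n"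
    unfolding y_def using binomial_symmetric[of n "Suc (2 * n)"] by (simp del: binomial_Suc_Suc)
  then have yz: "(2 * n + 1) * z = y * (n + 1)"
    using Suc_times_binomial_eq[of "2 * n" n] by (simp add: z_def del: binomial_Suc_Suc)
  have "(n + 1) * ((n + 1) * x) = 2 * (n + 1) * (y * (n + 1))"
    using xy by (simp add: algebra_simps)
  also have "\<dots> = (n + 1) * ((4 * n + 2) * z)"
    unfolding yz[symmetric] by (simp add: algebra_simps)
  also have "\<dots> = (n + 1) * ((n + 1) * ((4 * n + 2) * cat n))"
    unfolding z_def Suc[symmetric] by (simp only: mult_ac)
  also have "\<dots> = (n + 1) * ((n + 1) * ((n + 2) * cat (Suc n)))"
    unfolding cat_rec ..
  finally have "x = (n + 2) * cat (Suc n)"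
    by (simp only: mult_left_cancel[of "n + 1"] add_gr_0 zero_less_one simp_thms mult_cancel1 add_is_0 one_neq_zero)
  then show ?case by (simp only: x_def) simp
qed simp

lemma catalan_eq: "catalan n = int (cat n)"
  unfolding catalan_def cat_binomial[symmetric] by (subst nonzero_mult_div_cancel_left) simp_all

section \<open>Even and odd parts of the Catalan series\<close>

lemma sum_lessThan_double:
  fixes h :: "nat \<Rightarrow> 'a::comm_monoid_add"
  shows "(\<Sum>i<2 * n. h i) = (\<Sum>a<n. h (2 * a)) + (\<Sum>a<n. h (2 * a + 1))"
  by (induction n) (simp_all add: ac_simps)

definition evens :: "int fps" where "evens = Abs_fps (\<lambda>n. catalan (2 * n))"
text \<open>This is \<open>odds\<close> divided by \<open>fps_X\<close>. Starting at
  \<open>catalan 1\<close> keeps the index \<open>2 * n + 1\<close> free of truncated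
  subtraction.\<close>

definition odds_tail :: "int fps" where "odds_tail = Abs_fps (\<lambda>n. catalan (2 * n + 1))"
definition odds :: "int fps" where "odds = fps_X * odds_tail"

text \<open>The two indices in the convolution for the Catalan number at 2n+1 add up to 2n, so both
  are even or both are odd.\<close>

lemma odds_tail_eq: "odds_tail = evens * evens + fps_X * (odds_tail * odds_tail)"
proof (rule fps_ext)
  fix n
  let ?h = "\<lambda>i. catalan i * catalan (2 * n - i)"
  have "fps_nth odds_tail n = (\<Sum>i\<le>2 * n. ?h i)"
    by (simp add: odds_tail_def catalan_eq cat.simps(2))
  \<comment> \<open>Up to \<open>2 * n\<close> there is one more even index than odd ones; it is
    split off before pairing.\<close>
  also have "\<dots> = (\<Sum>i<2 * n. ?h i) + ?h (2 * n)"
    unfolding lessThan_Suc_atMost[symmetric] sum.lessThan_Suc ..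
  also have "\<dots> = (\<Sum>a\<le>n. ?h (2 * a)) + (\<Sum>a<n. ?h (2 * a + 1))"
    unfolding sum_lessThan_double by (simp add: lessThan_Suc_atMost[symmetric])
  also have "(\<Sum>a\<le>n. ?h (2 * a)) = fps_nth (evens * evens) n"
    by (simp add: fps_mult_nth evens_def atLeast0AtMost diff_mult_distrib2)
  also have "(\<Sum>a<n. ?h (2 * a + 1)) = fps_nth (fps_X * (odds_tail * odds_tail)) n"
  proof (cases n)
    case (Suc k)
    have "Suc (2 * k) - 2 * a = 2 * (k - a) + 1" if "a \<le> k" for a
      using that by simp
    then have "fps_nth (odds_tail * odds_tail) k = (\<Sum>a<n. ?h (2 * a + 1))"
      by (simp add: Suc fps_mult_nth odds_tail_def atLeast0AtMost lessThan_Suc_atMost)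
    then show ?thesis by (simp add: Suc)
  qed simp
  finally show "fps_nth odds_tail n = fps_nth (evens * evens + fps_X * (odds_tail * odds_tail)) n"
    by simp
qed

text \<open>Here the indices add up to an odd number, so exactly one of them is even; the two
  possibilities contribute equally, which gives the factor 2.\<close>

lemma evens_eq: "evens = 1 + 2 * (fps_X * (evens * odds_tail))"
proof (rule fps_ext)
  fix n
  show "fps_nth evens n = fps_nth (1 + 2 * (fps_X * (evens * odds_tail))) n"
  proof (cases n)
    case 0
    then show ?thesis by (simp add: evens_def catalan_eq numeral_fps_const)
  next
    case (Suc k)
    let ?h = "\<lambda>i. catalan i * catalan (2 * k + 1 - i)"
    have "fps_nth evens n = (\<Sum>i<2 * Suc k. ?h i)"
      by (simp add: Suc evens_def catalan_eq cat.simps(2) lessThan_Suc_atMost[symmetric])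
    also have "\<dots> = (\<Sum>a\<le>k. ?h (2 * a)) + (\<Sum>a\<le>k. ?h (2 * a + 1))"
      unfolding sum_lessThan_double lessThan_Suc_atMost ..
    also have "(\<Sum>a\<le>k. ?h (2 * a)) = fps_nth (evens * odds_tail) k"
    proof -
      have "Suc (2 * k) - 2 * a = 2 * (k - a) + 1" if "a \<le> k" for a
        using that by simp
      then show ?thesis
        by (simp add: fps_mult_nth odds_tail_def evens_def atLeast0AtMost)
    qed
    also have "(\<Sum>a\<le>k. ?h (2 * a + 1)) = fps_nth (odds_tail * evens) k"
      by (simp add: fps_mult_nth odds_tail_def evens_def atLeast0AtMost diff_mult_distrib2)
    finally show ?thesis
      by (simp add: Suc numeral_fps_const mult.commute)
  qed
qed

text \<open>Truncated subtraction makes \<open>codd 0\<close> equal to \<open>catalan 0\<close>,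
  that is 1, whereas the series has no constant term.\<close>

lemma odds_nth: "fps_nth odds n = (if n = 0 then 0 else codd n)"
  by (cases n) (simp_all add: odds_def odds_tail_def codd_def)

lemma evens_odds: "evens = 1 + 2 * (odds * evens)"
  using evens_eq by (simp add: odds_def mult_ac)

lemma odds_eq: "odds = fps_X * (evens * evens) + odds * odds"
proof -
  have "odds = fps_X * (evens * evens + fps_X * (odds_tail * odds_tail))"
    unfolding odds_def by (rule arg_cong[OF odds_tail_eq])
  also have "\<dots> = fps_X * (evens * evens) + odds * odds"
    unfolding odds_def distrib_left by (simp only: mult_ac)
  finally show ?thesis .
qed

text \<open>Both sides solve \<open>y = 1 + 4 x y\<^sup>2\<close>, which has a unique power series solution.\<close>
lemma evens_square: "evens * evens = Abs_fps (\<lambda>n. 4 ^ n * catalan n)"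
proof -
  define Z where "Z = Abs_fps (\<lambda>n. 4 ^ n * catalan n)"
  define Y where "Y = evens * evens"
  have Z: "Z = 1 + 4 * (fps_X * (Z * Z))"
  proof (rule fps_ext)
    fix n
    have "fps_nth (Z * Z) m = (\<Sum>i\<le>m. 4 ^ m * (catalan i * catalan (m - i)))" for m
      unfolding fps_mult_nth atLeast0AtMost
    proof (rule sum.cong[OF refl])
      fix i assume "i \<in> {..m}"
      then have "(4::int) ^ m = 4 ^ i * 4 ^ (m - i)"
        by (simp flip: power_add)
      then show "fps_nth Z i * fps_nth Z (m - i) = 4 ^ m * (catalan i * catalan (m - i))"
        by (simp add: Z_def)
    qed
    then have "4 * fps_nth (Z * Z) m = 4 ^ Suc m * catalan (Suc m)" for m
      by (simp add: catalan_eq cat.simps(2) flip: sum_distrib_left)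
    then show "fps_nth Z n = fps_nth (1 + 4 * (fps_X * (Z * Z))) n"
      by (cases n) (simp_all add: Z_def catalan_eq numeral_fps_const)
  qed
  \<comment> \<open>\<open>1 - 2 * odds\<close> is the inverse of \<open>evens\<close>. In its
    square only \<open>odds - odds * odds\<close> occurs, which \<open>odds_eq\<close> identifies as
    \<open>fps_X\<close> times \<open>Y\<close>.\<close>
  have "1 = evens * (1 - 2 * odds)"
    using evens_odds by (simp add: algebra_simps)
  then have "1 = (evens * (1 - 2 * odds)) * (evens * (1 - 2 * odds))"
    by (metis mult_1)
  also have "\<dots> = Y * (1 - 4 * (odds - odds * odds))"
    by (simp add: Y_def algebra_simps)
  also have "odds - odds * odds = fps_X * Y"
    using arg_cong[OF odds_eq, of "\<lambda>z. z - odds * odds"] by (simp add: Y_def)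
  finally have Y: "Y = 1 + 4 * (fps_X * (Y * Y))"
    by (simp add: algebra_simps)
  \<comment> \<open>Uniqueness: the difference of two solutions is annihilated by a series with
    constant term 1, and integer power series have no zero divisors.\<close>
  have "Y - Z = 4 * (fps_X * (Y * Y)) - 4 * (fps_X * (Z * Z))"
    by (subst Y, subst Z) simp
  then have "(Y - Z) * (1 - fps_X * (4 * (Y + Z))) = 0"
    by (simp add: algebra_simps)
  moreover have "fps_nth (1 - fps_X * (4 * (Y + Z))) 0 = 1"
    by simp
  then have "1 - fps_X * (4 * (Y + Z)) \<noteq> 0"
    by (metis fps_zero_nth zero_neq_one)
  ultimately show ?thesis by (simp add: Y_def Z_def)
qed

text \<open>The series of the triangulations of an odd polygon without diagonals parallel to the base.\<close>
definition caps :: "int fps" where "caps = odds - 2 * (odds * odds)"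

text \<open>In the coefficient of 2 x A^2 the factors 2 and \<open>4 ^ (n - 1)\<close> combine to
  the power \<open>2 ^ (2*n - 1)\<close> of \<open>g\<close>.\<close>

lemma caps_nth: "fps_nth caps n = (if n = 0 then 0 else g n)"
proof -
  have eq: "caps = 2 * (fps_X * (evens * evens)) - odds"
    using arg_cong[OF odds_eq, of "\<lambda>z. 2 * (z - odds * odds) - odds"]
    by (simp add: caps_def algebra_simps)
  show ?thesis
    unfolding eq evens_square
    by (cases n) (simp_all add: odds_nth g_def codd_def numeral_fps_const power_mult)
qed

section \<open>Sums over compositions\<close>

lemma fps_mult_nth_no_const:
  fixes F G :: "int fps"
  assumes "fps_nth F 0 = 0"
  shows "fps_nth (F * G) n = (\<Sum>r\<in>{1..n}. fps_nth F r * fps_nth G (n - r))"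
  unfolding fps_mult_nth using assms by (simp add: sum.atLeast_Suc_atMost)

lemma finite_comps: "finite (comps l n)"
  by (rule finite_subset[OF _ finite_lists_length_eq[of "{..n}" l]])
    (auto simp: comps_def dest: member_le_sum_list)

lemma sum_comps_0: "(\<Sum>is\<in>comps 0 n. F is) = (if n = 0 then F [] else 0)"
proof -
  have "comps 0 n = (if n = 0 then {[]} else {})" by (auto simp: comps_def)
  then show ?thesis by simp
qed

lemma sum_comps_Suc: "(\<Sum>is\<in>comps (Suc l) n. F is) = (\<Sum>i\<in>{1..n}. \<Sum>is\<in>comps l (n - i). F (i # is))"
proof -
  let ?A = "SIGMA i:{1..n}. comps l (n - i)"
  have "comps (Suc l) n = (\<lambda>(i, is). i # is) ` ?A"
  proof (intro set_eqI iffI)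
    fix xs assume xs: "xs \<in> comps (Suc l) n"
    then obtain i "is" where "xs = i # is" by (cases xs) (auto simp: comps_def)
    then show "xs \<in> (\<lambda>(i, is). i # is) ` ?A"
      using xs by (intro image_eqI[of _ _ "(i, is)"]) (auto simp: comps_def)
  qed (auto simp: comps_def)
  then have "(\<Sum>is\<in>comps (Suc l) n. F is) = (\<Sum>(i, is)\<in>?A. F (i # is))"
    by (simp add: sum.reindex inj_on_def split_def)
  also have "\<dots> = (\<Sum>i\<in>{1..n}. \<Sum>is\<in>comps l (n - i). F (i # is))"
    by (rule sum.Sigma[symmetric]) (auto simp: finite_comps)
  finally show ?thesis .
qed

lemma sum_comps_codd: "(\<Sum>is\<in>comps l n. prod_list (map codd is)) = fps_nth (odds ^ l) n"
proof (induction l arbitrary: n)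
  case (Suc l)
  have "(\<Sum>is\<in>comps (Suc l) n. prod_list (map codd is))
      = (\<Sum>i\<in>{1..n}. fps_nth odds i * fps_nth (odds ^ l) (n - i))"
    unfolding sum_comps_Suc by (rule sum.cong) (auto simp: odds_nth Suc simp flip: sum_distrib_left)
  then show ?case by (simp add: fps_mult_nth_no_const odds_nth)
qed (simp add: sum_comps_0)

lemma fps_nth_caps_mult: "fps_nth (caps * F) n = (\<Sum>i\<in>{1..n}. g i * fps_nth F (n - i))"
  by (subst fps_mult_nth_no_const) (auto simp: caps_nth intro!: sum.cong)

lemma fps_nth_double_power: "fps_nth ((2 * odds) ^ j) n = 2 ^ j * fps_nth (odds ^ j) n"
proof -
  have eq: "(2 * odds) ^ j = fps_const (2 ^ j) * odds ^ j"
    unfolding power_mult_distrib by (simp add: numeral_fps_const)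
  show ?thesis unfolding eq by simp
qed

lemma sum_comps_no_cap:
  "(\<Sum>is\<in>comps l n. 2 ^ l * prod_list (map codd is)) = fps_nth ((2 * odds) ^ l) n"
  unfolding fps_nth_double_power sum_comps_codd[symmetric] sum_distrib_left ..

lemma sum_comps_one_cap:
  "(\<Sum>is\<in>comps (Suc l) n. 2 ^ l * g (is ! 0) * prod_list (map codd (drop 1 is)))
    = fps_nth (caps * (2 * odds) ^ l) n"
  unfolding sum_comps_Suc fps_nth_caps_mult sum_comps_no_cap[symmetric] sum_distrib_left
  by (simp add: mult_ac)

text \<open>The two caps lie at opposite ends of the polygon, while the formula gives
  \<open>g\<close> to the first two entries. As series commute, the order of the pieces does not
  affect the sum.\<close>

lemma sum_comps_two_caps:
  "(\<Sum>is\<in>comps (Suc (Suc l)) n. 2 ^ l * g (is ! 0) * g (is ! 1) * prod_list (map codd (drop 2 is)))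
    = fps_nth (caps * (caps * (2 * odds) ^ l)) n"
  unfolding sum_comps_Suc[of _ "Suc l"] fps_nth_caps_mult[of "caps * (2 * odds) ^ l"]
    sum_comps_one_cap[symmetric] sum_distrib_left
  by (simp add: mult_ac numeral_2_eq_2)

section \<open>Maximal noncrossing sets of chords\<close>

text \<open>\<open>V\<close> stands for the convex polygon with these vertices in increasing order;
  gaps in the labels are allowed, so the pieces of a cut keep their labels.\<close>

definition chords :: "nat set \<Rightarrow> (nat \<times> nat) set" where
  "chords V = {(a, b). a \<in> V \<and> b \<in> V \<and> a < b}"

text \<open>The sides of the polygon cross nothing, so maximality puts all of them into every element
  of \<open>tris V\<close>, and no separate notion of diagonal is needed.\<close>
definition tris :: "nat set \<Rightarrow> (nat \<times> nat) set set" where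
  "tris V = {T. T = {q \<in> chords V. \<forall>p\<in>T. \<not> crosses p q}}"

lemma trisD: "T \<in> tris V \<Longrightarrow> q \<in> T \<longleftrightarrow> q \<in> chords V \<and> (\<forall>p\<in>T. \<not> crosses p q)"
  unfolding tris_def by blast

lemma trisI: "(\<And>q. q \<in> T \<longleftrightarrow> q \<in> chords V \<and> (\<forall>p\<in>T. \<not> crosses p q)) \<Longrightarrow> T \<in> tris V"
  unfolding tris_def by blast

lemma chords_iff: "(a, b) \<in> chords V \<longleftrightarrow> a \<in> V \<and> b \<in> V \<and> a < b"
  by (simp add: chords_def)

lemma finite_chords: "finite V \<Longrightarrow> finite (chords V)"
  by (rule finite_subset[of _ "V \<times> V"]) (auto simp: chords_def)

lemma tris_subset: "T \<in> tris V \<Longrightarrow> T \<subseteq> chords V"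
  using trisD by blast

lemma finite_tris: "finite V \<Longrightarrow> finite (tris V)"
  by (rule finite_subset[of _ "Pow (chords V)"]) (auto dest: tris_subset simp: finite_chords)

lemma finite_tri: "finite V \<Longrightarrow> T \<in> tris V \<Longrightarrow> finite T"
  using finite_subset finite_chords tris_subset by metis

lemma crosses_iff: "crosses (a, b) (c, d) \<longleftrightarrow> (a < c \<and> c < b \<and> b < d) \<or> (c < a \<and> a < d \<and> d < b)"
  by (simp add: crosses_def)

text \<open>Whether the two vertices are neighbours or the first and the last, all others lie on one
  side of the chord. Nothing crosses it, and maximality forces it into \<open>T\<close>.\<close>

lemma side_in_tri:
  assumes T: "T \<in> tris V" and ab: "a \<in> V" "b \<in> V" "a < b"
    and side: "(\<forall>x\<in>V. \<not> (a < x \<and> x < b)) \<or> (\<forall>x\<in>V. a \<le> x \<and> x \<le> b)"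
  shows "(a, b) \<in> T"
proof -
  have "\<not> crosses p (a, b)" if "p \<in> T" for p
  proof (cases p)
    case (Pair c d)
    then have "c \<in> V" "d \<in> V" "c < d"
      using that tris_subset[OF T] by (auto simp: chords_def)
    then show ?thesis
      using side unfolding Pair crosses_iff by fastforce
  qed
  then show ?thesis
    using ab by (simp add: trisD[OF T, of "(a, b)"] chords_iff)
qed

lemma chords_split:
  assumes "q \<in> chords V" "\<not> crosses (a, b) q"
  shows "q \<in> chords (V \<inter> {a..b}) \<or> q \<in> chords (V - {a<..<b})"
  using assms by (cases q) (auto simp: chords_iff crosses_iff)

lemma not_crosses_split:
  assumes "p \<in> chords (V \<inter> {a..b})" "q \<in> chords (V - {a<..<b})"
  shows "\<not> crosses p q" "\<not> crosses q p"
  using assms by (cases p; cases q; auto simp: chords_iff crosses_iff)+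

lemma chords_inter_split:
  assumes "q \<in> chords (V \<inter> {a..b})" "q \<in> chords (V - {a<..<b})"
  shows "q = (a, b)"
  using assms by (cases q) (auto simp: chords_iff)

text \<open>Chords on different sides of \<open>(a, b)\<close> never cross, so maximality can be
  tested in each half separately. The chord \<open>(a, b)\<close> is a side of both halves and is
  seen by both \<open>P\<close> and \<open>Q\<close>.\<close>

lemma split_card:
  fixes a b :: nat
  assumes ab: "a \<in> V" "b \<in> V" "a < b"
  defines "V1 \<equiv> V \<inter> {a..b}" and "V2 \<equiv> V - {a<..<b}"
  shows "card {T \<in> tris V. (a, b) \<in> T \<and> P (T \<inter> chords V1) \<and> Q (T \<inter> chords V2)}
    = card {T \<in> tris V1. P T} * card {T \<in> tris V2. Q T}"
proof -
  let ?X = "{T \<in> tris V. (a, b) \<in> T \<and> P (T \<inter> chords V1) \<and> Q (T \<inter> chords V2)}"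
  let ?Y = "{T \<in> tris V1. P T} \<times> {T \<in> tris V2. Q T}"
  have sub: "chords V1 \<subseteq> chords V" "chords V2 \<subseteq> chords V"
    by (auto simp: V1_def V2_def chords_def)
  have nc: "\<not> crosses p q" "\<not> crosses q p" if "p \<in> chords V1" "q \<in> chords V2" for p q
    using not_crosses_split that unfolding V1_def V2_def by blast+
  have ab1: "(a, b) \<in> T" if "T \<in> tris V1" for T
    using side_in_tri[OF that, of a b] ab by (auto simp: V1_def)
  have ab2: "(a, b) \<in> T" if "T \<in> tris V2" for T
    using side_in_tri[OF that, of a b] ab by (auto simp: V2_def)
  have part: "T = (T \<inter> chords V1) \<union> (T \<inter> chords V2)" if "T \<in> tris V" "(a, b) \<in> T" for T
    using chords_split[of _ V a b] trisD[OF that(1)] that(2) unfolding V1_def V2_def by blast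
  have restr: "T \<inter> chords V1 \<in> tris V1" "T \<inter> chords V2 \<in> tris V2" if "T \<in> tris V" "(a, b) \<in> T" for T
  proof -
    have "q \<in> T \<inter> chords V1 \<longleftrightarrow> q \<in> chords V1 \<and> (\<forall>p\<in>T \<inter> chords V1. \<not> crosses p q)" for q
      using part[OF that] trisD[OF that(1), of q] nc sub by blast
    then show "T \<inter> chords V1 \<in> tris V1" by (rule trisI)
    have "q \<in> T \<inter> chords V2 \<longleftrightarrow> q \<in> chords V2 \<and> (\<forall>p\<in>T \<inter> chords V2. \<not> crosses p q)" for q
      using part[OF that] trisD[OF that(1), of q] nc sub by blast
    then show "T \<inter> chords V2 \<in> tris V2" by (rule trisI)
  qed
  have cut1: "(T1 \<union> T2) \<inter> chords V1 = T1" and cut2: "(T1 \<union> T2) \<inter> chords V2 = T2"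
    if "T1 \<in> tris V1" "T2 \<in> tris V2" for T1 T2
    using chords_inter_split[of _ V a b] ab1[OF that(1)] ab2[OF that(2)]
      tris_subset[OF that(1)] tris_subset[OF that(2)] unfolding V1_def V2_def by blast+
  have join: "T1 \<union> T2 \<in> tris V" if T: "T1 \<in> tris V1" "T2 \<in> tris V2" for T1 T2
  proof (rule trisI)
    fix q
    note D = trisD[OF T(1), of q] trisD[OF T(2), of q]
    show "q \<in> T1 \<union> T2 \<longleftrightarrow> q \<in> chords V \<and> (\<forall>p\<in>T1 \<union> T2. \<not> crosses p q)" (is "?l \<longleftrightarrow> ?r")
    proof
      assume ?l
      then show ?r
        using D nc sub tris_subset[OF T(1)] tris_subset[OF T(2)] by blast
    next
      assume ?r
      \<comment> \<open>\<open>(a, b)\<close> belongs to \<open>T1\<close>, so \<open>q\<close> does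
        not cross it and lies in one half.\<close>
      then have "q \<in> chords V1 \<or> q \<in> chords V2"
        using chords_split[of q V a b] ab1[OF T(1)] unfolding V1_def V2_def by blast
      then show ?l using D \<open>?r\<close> by blast
    qed
  qed
  have "bij_betw (\<lambda>T. (T \<inter> chords V1, T \<inter> chords V2)) ?X ?Y"
  proof (rule bij_betw_byWitness[where f' = "\<lambda>(T1, T2). T1 \<union> T2"])
    show "\<forall>T\<in>?X. (case (T \<inter> chords V1, T \<inter> chords V2) of (T1, T2) \<Rightarrow> T1 \<union> T2) = T"
      using part by auto
    show "\<forall>z\<in>?Y. ((case z of (T1, T2) \<Rightarrow> T1 \<union> T2) \<inter> chords V1,
        (case z of (T1, T2) \<Rightarrow> T1 \<union> T2) \<inter> chords V2) = z"
      using cut1 cut2 by auto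
    show "(\<lambda>T. (T \<inter> chords V1, T \<inter> chords V2)) ` ?X \<subseteq> ?Y"
      using restr by auto
    show "(\<lambda>(T1, T2). T1 \<union> T2) ` ?Y \<subseteq> ?X"
      using cut1 cut2 join ab1 by auto
  qed
  from bij_betw_same_card[OF this] show ?thesis
    by (simp only: card_cartesian_product)
qed

section \<open>Counting all triangulations through the triangle on the longest side\<close>

lemma bij_rank:
  fixes V :: "nat set"
  assumes "finite V"
  shows "bij_betw (\<lambda>c. card {x \<in> V. x < c}) V {..<card V}"
proof -
  have mono: "card {x \<in> V. x < c} < card {x \<in> V. x < d}" if "c \<in> V" "c < d" for c d
    by (rule psubset_card_mono) (use assms that in auto)
  have inj: "inj_on (\<lambda>c. card {x \<in> V. x < c}) V"
  proof (rule inj_onI)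
    fix c d assume "c \<in> V" "d \<in> V" "card {x \<in> V. x < c} = card {x \<in> V. x < d}"
    then show "c = d" using mono[of c d] mono[of d c] by (cases c d rule: linorder_cases) auto
  qed
  have "card {x \<in> V. x < c} < card V" if "c \<in> V" for c
    by (rule psubset_card_mono) (use assms that in auto)
  then have "(\<lambda>c. card {x \<in> V. x < c}) ` V \<subseteq> {..<card V}"
    by auto
  then have "(\<lambda>c. card {x \<in> V. x < c}) ` V = {..<card V}"
    using card_image[OF inj] by (intro card_subset_eq) auto
  with inj show ?thesis by (simp add: bij_betw_def)
qed

lemma tris_no_crossing:
  assumes "\<And>p q. p \<in> chords V \<Longrightarrow> q \<in> chords V \<Longrightarrow> \<not> crosses p q"
  shows "tris V = {chords V}"
proof -
  have "T = chords V" if "T \<in> tris V" for T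
    using trisD[OF that] assms tris_subset[OF that] by blast
  moreover have "chords V \<in> tris V"
    using assms by (intro trisI) blast
  ultimately show ?thesis by blast
qed

text \<open>The third vertex of the triangle on \<open>(lo, hi)\<close> is the largest neighbour of
  \<open>lo\<close> below \<open>hi\<close>. It is unique because for candidates
  \<open>c < d\<close> the chords \<open>(c, hi)\<close> and \<open>(lo, d)\<close> cross.\<close>

lemma apex:
  assumes V: "finite V" and lo: "lo \<in> V" "\<And>x. x \<in> V \<Longrightarrow> lo \<le> x"
    and hi: "hi \<in> V" "\<And>x. x \<in> V \<Longrightarrow> x \<le> hi"
    and x: "x \<in> V" "lo < x" "x < hi" and T: "T \<in> tris V"
  shows "\<exists>!c. c \<in> V \<and> lo < c \<and> c < hi \<and> (lo, c) \<in> T \<and> (c, hi) \<in> T"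
proof (rule ex_ex1I)
  define S where "S = {c \<in> V. lo < c \<and> c < hi \<and> (lo, c) \<in> T}"
  have finS: "finite S" using V by (auto simp: S_def)
  \<comment> \<open>The successor of \<open>lo\<close> is joined to it by a side, so there is at
    least one candidate.\<close>
  define m where "m = Min {y \<in> V. lo < y}"
  have m: "m \<in> {y \<in> V. lo < y}"
    unfolding m_def by (rule Min_in) (use V x in auto)
  have m_le: "m \<le> y" if "y \<in> V" "lo < y" for y
    unfolding m_def by (rule Min_le) (use V that in auto)
  have "(lo, m) \<in> T"
    by (rule side_in_tri[OF T]) (use m m_le lo in fastforce)+
  moreover have "m < hi" using m_le x by fastforce
  ultimately have "S \<noteq> {}" using m by (auto simp: S_def)
  define c where "c = Max S"
  have cS: "c \<in> S" unfolding c_def using finS \<open>S \<noteq> {}\<close> by (rule Max_in)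
  have cmax: "y \<le> c" if "y \<in> S" for y
    unfolding c_def using finS that by (rule Max_ge)
  have "\<not> crosses p (c, hi)" if "p \<in> T" for p
  proof
    assume cr: "crosses p (c, hi)"
    obtain u v where p: "p = (u, v)" by (cases p)
    have uv: "u \<in> V" "v \<in> V" "u < v"
      using that tris_subset[OF T] by (auto simp: p chords_iff)
    have "u < c" "c < v" "v < hi"
      using cr hi(2)[OF uv(2)] by (auto simp: p crosses_iff)
    show False
    \<comment> \<open>A chord crossing \<open>(c, hi)\<close> either joins \<open>lo\<close> to a
      vertex beyond \<open>c\<close>, against the choice of \<open>c\<close>, or crosses
      \<open>(lo, c)\<close>.\<close>
    proof (cases "u = lo")
      case True
      then have "v \<in> S" using that uv \<open>v < hi\<close> by (auto simp: S_def p)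
      then show False using cmax \<open>c < v\<close> by fastforce
    next
      case False
      then have "crosses (u, v) (lo, c)"
        using lo(2)[OF uv(1)] \<open>u < c\<close> \<open>c < v\<close> by (auto simp: crosses_iff)
      then show False
        using trisD[OF T, of "(lo, c)"] cS that by (auto simp: S_def p)
    qed
  qed
  then have "(c, hi) \<in> T"
    using cS hi trisD[OF T, of "(c, hi)"] by (auto simp: S_def chords_iff)
  then show "\<exists>c. c \<in> V \<and> lo < c \<and> c < hi \<and> (lo, c) \<in> T \<and> (c, hi) \<in> T"
    using cS by (auto simp: S_def)
next
  have no: False if "(c, hi) \<in> T" "(lo, d) \<in> T" "lo < c" "c < d" "d < hi" for c d
    using trisD[OF T, of "(lo, d)"] that by (auto simp: crosses_iff)
  fix c d
  assume "c \<in> V \<and> lo < c \<and> c < hi \<and> (lo, c) \<in> T \<and> (c, hi) \<in> T"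
    "d \<in> V \<and> lo < d \<and> d < hi \<and> (lo, d) \<in> T \<and> (d, hi) \<in> T"
  then show "c = d"
    using no[of c d] no[of d c] by (cases c d rule: linorder_cases) auto
qed

text \<open>Two successive cuts, along \<open>(c, hi)\<close> and along \<open>(lo, c)\<close>,
  leave a triangle between them, which has a single triangulation.\<close>

lemma card_apex:
  assumes V: "finite V" and lo: "lo \<in> V" "\<And>x. x \<in> V \<Longrightarrow> lo \<le> x"
    and hi: "hi \<in> V" "\<And>x. x \<in> V \<Longrightarrow> x \<le> hi"
    and c: "c \<in> V" "lo < c" "c < hi"
  shows "card {T \<in> tris V. (lo, c) \<in> T \<and> (c, hi) \<in> T}
    = card (tris (V \<inter> {..c})) * card (tris (V \<inter> {c..}))"
proof -
  let ?V2 = "V - {c<..<hi}"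
  have memV2: "(lo, c) \<in> chords ?V2" using c lo by (auto simp: chords_iff)
  have tri3: "tris {lo, c, hi} = {chords {lo, c, hi}}"
    using c by (intro tris_no_crossing) (auto simp: chords_iff crosses_iff)
  have e1: "V \<inter> {c..hi} = V \<inter> {c..}" "?V2 \<inter> {lo..c} = V \<inter> {..c}"
    "?V2 - {lo<..<c} = {lo, c, hi}"
    using lo hi c by (fastforce simp: le_less)+
  have "card {T \<in> tris V. (lo, c) \<in> T \<and> (c, hi) \<in> T}
      = card {T \<in> tris V. (c, hi) \<in> T \<and> True \<and> (lo, c) \<in> T \<inter> chords ?V2}"
    using memV2 by (intro arg_cong[where f = card]) auto
  also have "\<dots> = card {T \<in> tris (V \<inter> {c..hi}). True} * card {T \<in> tris ?V2. (lo, c) \<in> T}"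
    by (rule split_card) (use c hi in auto)
  also have "card {T \<in> tris ?V2. (lo, c) \<in> T}
      = card {T \<in> tris (?V2 \<inter> {lo..c}). True} * card {T \<in> tris (?V2 - {lo<..<c}). True}"
    using split_card[of lo ?V2 c "\<lambda>_. True" "\<lambda>_. True"] memV2 by (simp add: chords_iff)
  finally show ?thesis by (simp add: e1 tri3)
qed

lemma card_tris_rec:
  assumes V: "finite V" "card V = Suc (Suc (Suc n))"
    and IH: "\<And>W. finite W \<Longrightarrow> 2 \<le> card W \<Longrightarrow> card W < card V \<Longrightarrow> card (tris W) = t (card W - 2)"
  shows "card (tris V) = (\<Sum>i\<le>n. t i * t (n - i))"
proof -
  define lo hi where "lo = Min V" and "hi = Max V"
  have ne: "V \<noteq> {}" using V by auto
  have lo: "lo \<le> x" if "x \<in> V" for x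
    using V(1) ne that by (auto simp: lo_def)
  have lo': "lo \<in> V" using V(1) ne by (auto simp: lo_def)
  have hi': "hi \<in> V" using V(1) ne by (auto simp: hi_def)
  have hi: "x \<le> hi" if "x \<in> V" for x
    using V(1) ne that by (auto simp: hi_def)
  define M where "M = V - {lo, hi}"
  have M: "c \<in> M \<longleftrightarrow> c \<in> V \<and> lo < c \<and> c < hi" for c
    using lo[of c] hi[of c] lo' hi' by (auto simp: M_def)
  have lohi: "lo \<noteq> hi"
  proof (rule notI)
    assume eq: "lo = hi"
    have "x = lo" if "x \<in> V" for x using lo[OF that] hi[OF that] eq by linarith
    then have sub: "V \<subseteq> {lo}" by blast
    have "card V \<le> card {lo}" by (rule card_mono[OF _ sub]) simp
    then show False using V(2) by simp
  qed
  have cardM: "card M = Suc n"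
    using V lo' hi' lohi card_Diff_subset[of "{lo, hi}" V] unfolding M_def by simp
  have finM: "finite M" using V by (simp add: M_def)
  then obtain x where x: "x \<in> M" using cardM by (metis card.empty nat.distinct(1) ex_in_conv)
  let ?A = "\<lambda>c. {T \<in> tris V. (lo, c) \<in> T \<and> (c, hi) \<in> T}"
  have ap: "\<exists>!c. c \<in> M \<and> (lo, c) \<in> T \<and> (c, hi) \<in> T" if "T \<in> tris V" for T
    using apex[OF V(1) lo' lo hi' hi _ _ _ that, of x] x unfolding M by (simp add: conj_ac)
  have cover: "tris V = (\<Union>c\<in>M. ?A c)"
    using ap by fast
  have disj: "?A c \<inter> ?A d = {}" if "c \<in> M" "d \<in> M" "c \<noteq> d" for c d
    using ap that by blast
  have finA: "finite (?A c)" for c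
    using finite_tris[OF V(1)] by simp
  have "card (tris V) = card (\<Union>c\<in>M. ?A c)"
    using cover by (rule arg_cong)
  also have "\<dots> = (\<Sum>c\<in>M. card (?A c))"
    using finM finA disj by (intro card_UN_disjoint) blast+
  also have "\<dots> = (\<Sum>c\<in>M. t (card {x \<in> M. x < c}) * t (n - card {x \<in> M. x < c}))"
  proof (rule sum.cong[OF refl])
    fix c assume c: "c \<in> M"
    have cM: "c \<in> V" "lo < c" "c < hi" using c unfolding M by auto
    have eq: "V \<inter> {..c} = insert lo (insert c {x \<in> M. x < c})"
      using cM lo' lo hi by (auto simp: M le_less)
    have c1: "card (V \<inter> {..c}) = Suc (Suc (card {x \<in> M. x < c}))"
      unfolding eq using cM finM by (auto simp: M)
    have "card V = card (V \<inter> {..c} \<union> (V \<inter> {c..} - {c}))"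
      by (rule arg_cong[where f = card]) auto
    also have "\<dots> = card (V \<inter> {..c}) + card (V \<inter> {c..} - {c})"
      by (rule card_Un_disjoint) (use V in auto)
    also have "card (V \<inter> {c..} - {c}) = card (V \<inter> {c..}) - 1"
      using cM V by (simp add: card_Diff_subset)
    \<comment> \<open>The apex \<open>c\<close> belongs to both halves and would be counted
      twice.\<close>
    finally have c2: "card V = card (V \<inter> {..c}) + card (V \<inter> {c..}) - 1"
      using cM V card_gt_0_iff[of "V \<inter> {c..}"] by auto
    have "{c, hi} \<subseteq> V \<inter> {c..}" using cM hi' by auto
    then have c3: "2 \<le> card (V \<inter> {c..})"
      using card_mono[of "V \<inter> {c..}" "{c, hi}"] V cM by auto
    have c4: "card {x \<in> M. x < c} < card M"
      by (rule psubset_card_mono) (use finM c in auto)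
    have "card (?A c) = card (tris (V \<inter> {..c})) * card (tris (V \<inter> {c..}))"
      by (rule card_apex) (use V lo' lo hi hi' cM in auto)
    also have "card (tris (V \<inter> {..c})) = t (card (V \<inter> {..c}) - 2)"
      by (rule IH) (use V c1 c2 c3 c4 cardM in auto)
    also have "card (tris (V \<inter> {c..})) = t (card (V \<inter> {c..}) - 2)"
      by (rule IH) (use V c1 c2 c3 c4 cardM in auto)
    also have "card (V \<inter> {c..}) - 2 = n - card {x \<in> M. x < c}"
      using c1 c2 c3 V(2) by simp
    finally show "card (?A c) = t (card {x \<in> M. x < c}) * t (n - card {x \<in> M. x < c})"
      using c1 by simp
  qed
  also have "\<dots> = (\<Sum>i<card M. t i * t (n - i))"
    using sum.reindex_bij_betw[OF bij_rank[OF finM], of "\<lambda>i. t i * t (n - i)"] by simp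
  finally show ?thesis by (simp add: cardM lessThan_Suc_atMost)
qed

text \<open>The degenerate polygon with two vertices is a single chord; it supplies the initial
  value of the recurrence.\<close>

lemma card_tris_2: "card V = 2 \<Longrightarrow> card (tris V) = 1"
proof -
  assume "card V = 2"
  then obtain x y where "V = {x, y}" by (auto simp: card_2_iff)
  then show ?thesis
    by (subst tris_no_crossing) (auto simp: chords_iff crosses_iff)
qed

lemma card_tris:
  assumes t0: "t 0 = 1" and tS: "\<And>n. t (Suc n) = (\<Sum>i\<le>n. t i * t (n - i))"
    and V: "finite V" "2 \<le> card V"
  shows "card (tris V) = t (card V - 2)"
  using V
proof (induction "card V" arbitrary: V rule: less_induct)
  case less
  show ?case
  proof (cases "card V = 2")
    case True
    then show ?thesis by (simp add: card_tris_2 t0)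
  next
    case False
    then obtain n where n: "card V = Suc (Suc (Suc n))"
      using less.prems(2) by (metis Suc_le_D add_2_eq_Suc not0_implies_Suc numeral_2_eq_2 Suc_le_mono nat.inject)
    show ?thesis
      using card_tris_rec[OF less.prems(1) n, of t] less.hyps n tS by simp
  qed
qed

section \<open>Symmetric polygons and their rungs\<close>

text \<open>The bound \<open>m\<close> on the left end serves to skip an outermost rung that is a
  side and so belongs to every triangulation.\<close>

definition rungs :: "nat \<Rightarrow> nat \<Rightarrow> (nat \<times> nat) set" where
  "rungs s m = {(a, b). a + b = s \<and> m \<le> a}"

text \<open>Cut along the outermost rung of \<open>T\<close> that starts at or after \<open>m\<close>.\<close>
lemma first_rung:
  assumes V: "finite V"
  shows "card {T \<in> tris V. T \<inter> rungs s m \<noteq> {} \<and> Q (card (T \<inter> rungs s m))}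
    = (\<Sum>a\<in>{a \<in> V. m \<le> a \<and> s - a \<in> V \<and> 2 * a < s}.
        card {T \<in> tris (V - {a<..<s - a}). T \<inter> rungs s m = {(a, s - a)}}
        * card {T \<in> tris (V \<inter> {a..s - a}). Q (card (T \<inter> rungs s 0))})"
proof -
  define I where "I = {a \<in> V. m \<le> a \<and> s - a \<in> V \<and> 2 * a < s}"
  define C1 where "C1 a = chords (V \<inter> {a..s - a})" for a
  define C2 where "C2 a = chords (V - {a<..<s - a})" for a
  define X where "X a = {T \<in> tris V. (a, s - a) \<in> T \<and> Q (card ((T \<inter> C1 a) \<inter> rungs s 0))
    \<and> (T \<inter> C2 a) \<inter> rungs s m = {(a, s - a)}}" for a
  have finI: "finite I" using V by (simp add: I_def)
  have rung: "\<exists>a\<in>I. p = (a, s - a)" if "T \<in> tris V" "p \<in> T \<inter> rungs s m" for T p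
    using that tris_subset[OF that(1)] by (cases p) (auto simp: rungs_def I_def chords_def)
  \<comment> \<open>Rungs are nested: those with left end at most \<open>a\<close> are exactly the
    ones in the outer half. Seeing only the cut there means that no earlier rung exists.\<close>
  have first: "(T \<inter> C2 a) \<inter> rungs s m = {(a, s - a)} \<longleftrightarrow> (\<forall>(x, y)\<in>T \<inter> rungs s m. a \<le> x)"
    if T: "T \<in> tris V" "(a, s - a) \<in> T" "a \<in> I" for T a
  proof
    assume eq: "(T \<inter> C2 a) \<inter> rungs s m = {(a, s - a)}"
    show "\<forall>(x, y)\<in>T \<inter> rungs s m. a \<le> x"
    proof (rule ballI, rule ccontr)
      fix p assume p: "p \<in> T \<inter> rungs s m" "\<not> (case p of (x, y) \<Rightarrow> a \<le> x)"
      obtain x where x: "x \<in> I" "p = (x, s - x)" using rung[OF T(1) p(1)] by blast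
      then have "p \<in> C2 a" using p(2) T(3) by (auto simp: C2_def chords_iff I_def)
      then show False using eq p x by auto
    qed
  next
    assume min: "\<forall>(x, y)\<in>T \<inter> rungs s m. a \<le> x"
    have "p = (a, s - a)" if p: "p \<in> T" "p \<in> C2 a" "p \<in> rungs s m" for p
    proof -
      obtain x where x: "x \<in> I" "p = (x, s - x)" using rung[OF T(1)] p by blast
      have "a \<le> x" using min p x by auto
      then show ?thesis using p(2) x T(3) by (auto simp: C2_def chords_iff I_def)
    qed
    moreover have "(a, s - a) \<in> C2 a \<inter> rungs s m"
      using T(3) by (auto simp: C2_def chords_iff I_def rungs_def)
    ultimately show "(T \<inter> C2 a) \<inter> rungs s m = {(a, s - a)}"
      using T(2) by blast
  qed
  \<comment> \<open>Conversely all rungs lie in the inner half once \<open>a\<close> is the smallest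
    left end, and there the bound \<open>m\<close> holds automatically.\<close>
  have later: "(T \<inter> C1 a) \<inter> rungs s 0 = T \<inter> rungs s m"
    if T: "T \<in> tris V" "a \<in> I" "\<forall>(x, y)\<in>T \<inter> rungs s m. a \<le> x" for T a
  proof -
    have "p \<in> C1 a \<and> p \<in> rungs s 0" if p: "p \<in> T" "p \<in> rungs s m" for p
    proof -
      obtain x where x: "x \<in> I" "p = (x, s - x)" using rung[OF T(1)] p by blast
      have "a \<le> x" using T(3) p x by auto
      then show ?thesis using x T(2) by (auto simp: C1_def chords_iff I_def rungs_def)
    qed
    moreover have "p \<in> rungs s m" if "p \<in> C1 a" "p \<in> rungs s 0" for p
      using that T(2) by (cases p) (auto simp: C1_def chords_iff I_def rungs_def)
    ultimately show ?thesis by blast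
  qed
  have disj: "X a \<inter> X b = {}" if "a \<in> I" "b \<in> I" "a \<noteq> b" for a b
  proof -
    have le: "c \<le> d" if "c \<in> I" "d \<in> I" "T \<in> X c" "T \<in> X d" for c d T
      using that first[of T c] by (force simp: X_def I_def rungs_def)
    show ?thesis using le[OF that(1,2)] le[OF that(2,1)] that(3) by (meson disjoint_iff le_antisym)
  qed
  have "{T \<in> tris V. T \<inter> rungs s m \<noteq> {} \<and> Q (card (T \<inter> rungs s m))} = (\<Union>a\<in>I. X a)"
  proof (intro set_eqI iffI)
    fix T assume "T \<in> {T \<in> tris V. T \<inter> rungs s m \<noteq> {} \<and> Q (card (T \<inter> rungs s m))}"
    then have T: "T \<in> tris V" "T \<inter> rungs s m \<noteq> {}" "Q (card (T \<inter> rungs s m))" by auto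
    define J where "J = {a \<in> I. (a, s - a) \<in> T}"
    have J: "finite J" "J \<noteq> {}" using finI rung[OF T(1)] T(2) by (auto simp: J_def)
    define a where "a = Min J"
    have a: "a \<in> I" "(a, s - a) \<in> T" using Min_in[OF J] by (auto simp: a_def J_def)
    have min: "\<forall>(x, y)\<in>T \<inter> rungs s m. a \<le> x"
      using rung[OF T(1)] Min_le[OF J(1)] by (fastforce simp: a_def J_def)
    show "T \<in> (\<Union>a\<in>I. X a)"
      using a T later[OF T(1) a(1) min] first[OF T(1) a(2,1)] min by (auto simp: X_def)
  next
    fix T assume "T \<in> (\<Union>a\<in>I. X a)"
    then obtain a where a: "a \<in> I" "T \<in> X a" by blast
    then have T: "T \<in> tris V" "(a, s - a) \<in> T" and q: "Q (card ((T \<inter> C1 a) \<inter> rungs s 0))"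
      by (auto simp: X_def)
    have min: "\<forall>(x, y)\<in>T \<inter> rungs s m. a \<le> x"
      using first[OF T a(1)] a(2) by (simp add: X_def)
    have "(a, s - a) \<in> rungs s m" using a(1) by (auto simp: I_def rungs_def)
    then show "T \<in> {T \<in> tris V. T \<inter> rungs s m \<noteq> {} \<and> Q (card (T \<inter> rungs s m))}"
      using T q later[OF T(1) a(1) min] by auto
  qed
  then have "card {T \<in> tris V. T \<inter> rungs s m \<noteq> {} \<and> Q (card (T \<inter> rungs s m))} = card (\<Union>a\<in>I. X a)"
    by (rule arg_cong)
  also have "\<dots> = (\<Sum>a\<in>I. card (X a))"
  proof (rule card_UN_disjoint)
    show "\<forall>a\<in>I. finite (X a)" using finite_tris[OF V] by (simp add: X_def)
  qed (use finI disj in auto)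
  also have "\<dots> = (\<Sum>a\<in>I. card {T \<in> tris (V - {a<..<s - a}). T \<inter> rungs s m = {(a, s - a)}}
        * card {T \<in> tris (V \<inter> {a..s - a}). Q (card (T \<inter> rungs s 0))})"
  proof (rule sum.cong[OF refl])
    fix a assume "a \<in> I"
    then have "a \<in> V" "s - a \<in> V" "a < s - a" by (auto simp: I_def)
    from split_card[OF this, of "\<lambda>T. Q (card (T \<inter> rungs s 0))" "\<lambda>T. T \<inter> rungs s m = {(a, s - a)}"]
    show "card (X a) = card {T \<in> tris (V - {a<..<s - a}). T \<inter> rungs s m = {(a, s - a)}}
        * card {T \<in> tris (V \<inter> {a..s - a}). Q (card (T \<inter> rungs s 0))}"
      unfolding X_def C1_def C2_def by (simp only: mult.commute)
  qed
  finally show ?thesis unfolding I_def .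
qed

text \<open>Invariance under the reflection that swaps the ends of every rung;
  \<open>x \<le> s\<close> makes the subtraction genuine.\<close>

definition symmetric :: "nat \<Rightarrow> nat set \<Rightarrow> bool" where
  "symmetric s V \<longleftrightarrow> finite V \<and> (\<forall>x\<in>V. x \<le> s \<and> s - x \<in> V)"

definition lower :: "nat \<Rightarrow> nat set \<Rightarrow> nat set" where
  "lower s V = {x \<in> V. 2 * x < s}"

text \<open>The vertex on the axis, if any. For symmetric \<open>V\<close> its presence decides
  whether the inner end of the polygon is a tip or a side.\<close>

definition center :: "nat \<Rightarrow> nat set \<Rightarrow> nat set" where
  "center s V = {x \<in> V. 2 * x = s}"

definition ladders :: "nat \<Rightarrow> nat set \<Rightarrow> (nat \<Rightarrow> bool) \<Rightarrow> int" where
  "ladders s V Q = int (card {T \<in> tris V. Q (card (T \<inter> rungs s 0))})"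

lemma finite_lower: "symmetric s V \<Longrightarrow> finite (lower s V)"
  by (simp add: symmetric_def lower_def)

lemma card_symmetric:
  assumes "symmetric s V"
  shows "card V = 2 * card (lower s V) + card (center s V)"
proof -
  have fin: "finite V" and sym: "\<And>x. x \<in> V \<Longrightarrow> x \<le> s \<and> s - x \<in> V"
    using assms by (auto simp: symmetric_def)
  have "bij_betw (\<lambda>x. s - x) {x \<in> V. s < 2 * x} (lower s V)"
    by (rule bij_betw_byWitness[where f' = "\<lambda>x. s - x"]) (use sym in \<open>fastforce simp: lower_def\<close>)+
  then have upper: "card {x \<in> V. s < 2 * x} = card (lower s V)"
    by (rule bij_betw_same_card)
  have "card V = card ((lower s V \<union> center s V) \<union> {x \<in> V. s < 2 * x})"
    by (rule arg_cong[where f = card]) (auto simp: lower_def center_def)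
  also have "\<dots> = card (lower s V \<union> center s V) + card {x \<in> V. s < 2 * x}"
    by (rule card_Un_disjoint) (use fin in \<open>auto simp: lower_def center_def\<close>)
  also have "card (lower s V \<union> center s V) = card (lower s V) + card (center s V)"
    by (rule card_Un_disjoint) (use fin in \<open>auto simp: lower_def center_def\<close>)
  finally show ?thesis using upper by simp
qed

lemma symmetric_inner:
  assumes "symmetric s V" "a \<in> lower s V"
  shows "symmetric s (V \<inter> {a..s - a})" "center s (V \<inter> {a..s - a}) = center s V"
    "card (lower s (V \<inter> {a..s - a})) = card (lower s V) - card {x \<in> lower s V. x < a}"
proof -
  show "symmetric s (V \<inter> {a..s - a})" "center s (V \<inter> {a..s - a}) = center s V"
    using assms by (auto simp: symmetric_def lower_def center_def)
  have "lower s (V \<inter> {a..s - a}) = lower s V - {x \<in> lower s V. x < a}"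
    using assms by (auto simp: lower_def)
  then show "card (lower s (V \<inter> {a..s - a})) = card (lower s V) - card {x \<in> lower s V. x < a}"
    using finite_lower[OF assms(1)] by (simp add: card_Diff_subset)
qed

text \<open>With \<open>r\<close> the rank of \<open>a\<close> among the lower vertices, the outer
  piece has \<open>r + 1\<close> mirror pairs. The pair of \<open>a\<close> belongs to the inner
  piece as well.\<close>

lemma symmetric_outer:
  assumes "symmetric s V" "a \<in> lower s V"
  shows "symmetric s (V - {a<..<s - a})" "center s (V - {a<..<s - a}) = {}"
    "card (lower s (V - {a<..<s - a})) = Suc (card {x \<in> lower s V. x < a})"
proof -
  show "symmetric s (V - {a<..<s - a})" "center s (V - {a<..<s - a}) = {}"
    using assms by (auto simp: symmetric_def lower_def center_def)
  have "lower s (V - {a<..<s - a}) = insert a {x \<in> lower s V. x < a}"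
    using assms by (auto simp: lower_def)
  then show "card (lower s (V - {a<..<s - a})) = Suc (card {x \<in> lower s V. x < a})"
    using finite_lower[OF assms(1)] by simp
qed

lemma outer_rung:
  assumes V: "symmetric s V" "T \<in> tris V" "lower s V \<noteq> {}"
  shows "(Min (lower s V), s - Min (lower s V)) \<in> T"
proof -
  let ?m = "Min (lower s V)"
  have m: "?m \<in> lower s V" using finite_lower V by simp
  have "?m \<le> x \<and> x \<le> s - ?m" if "x \<in> V" for x
  proof -
    have min: "?m \<le> y" if "y \<in> lower s V" for y using finite_lower V that by simp
    have "s - x \<in> V" "x \<le> s" using V(1) \<open>x \<in> V\<close> by (auto simp: symmetric_def)
    then show ?thesis
      using min[of x] min[of "s - x"] m \<open>x \<in> V\<close> by (auto simp: lower_def not_less) linarith+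
  qed
  then show ?thesis
    using m V(1) by (intro side_in_tri[OF V(2)]) (auto simp: symmetric_def lower_def)
qed

text \<open>A vertex strictly between the two ends would, by itself or through its mirror image, be
  a lower vertex beyond the maximum, as none lies on the axis.\<close>

lemma inner_rung:
  assumes V: "symmetric s V" "T \<in> tris V" "lower s V \<noteq> {}" "center s V = {}"
  shows "(Max (lower s V), s - Max (lower s V)) \<in> T"
proof -
  let ?m = "Max (lower s V)"
  have m: "?m \<in> lower s V" using finite_lower V by simp
  have "\<not> (?m < x \<and> x < s - ?m)" if "x \<in> V" for x
  proof -
    have max: "y \<le> ?m" if "y \<in> lower s V" for y using finite_lower V that by simp
    have "s - x \<in> V" "x \<le> s" using V(1) \<open>x \<in> V\<close> by (auto simp: symmetric_def)
    moreover have "2 * x \<noteq> s" using V(4) \<open>x \<in> V\<close> by (auto simp: center_def)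
    ultimately have "x \<in> lower s V \<or> s - x \<in> lower s V \<and> x \<le> s"
      using \<open>x \<in> V\<close> unfolding lower_def by auto
    then show ?thesis
      using max[of x] max[of "s - x"] by linarith
  qed
  then show ?thesis
    using m V(1) by (intro side_in_tri[OF V(2)]) (auto simp: symmetric_def lower_def)
qed

lemma card_rungs_le:
  assumes V: "symmetric s V" "T \<in> tris V"
  shows "card (T \<inter> rungs s 0) \<le> card (lower s V)"
proof (rule surj_card_le)
  show "T \<inter> rungs s 0 \<subseteq> (\<lambda>x. (x, s - x)) ` lower s V"
    using tris_subset[OF V(2)] by (auto simp: rungs_def lower_def chords_def intro!: rev_image_eqI)
qed (rule finite_lower[OF V(1)])

lemma card_rungs_ge_1:
  assumes V: "symmetric s V" "T \<in> tris V" "lower s V \<noteq> {}"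
  shows "1 \<le> card (T \<inter> rungs s 0)"
proof -
  have "Min (lower s V) \<in> lower s V" using finite_lower V by simp
  then have "(Min (lower s V), s - Min (lower s V)) \<in> T \<inter> rungs s 0"
    using outer_rung[OF V] by (auto simp: rungs_def lower_def)
  moreover have "finite (T \<inter> rungs s 0)"
    using V finite_tri by (auto simp: symmetric_def)
  ultimately show ?thesis by (metis One_nat_def Suc_leI card_gt_0_iff empty_iff)
qed

lemma card_rungs_ge_2:
  assumes V: "symmetric s V" "T \<in> tris V" "center s V = {}" "2 \<le> card (lower s V)"
  shows "2 \<le> card (T \<inter> rungs s 0)"
proof -
  let ?L = "lower s V"
  have fin: "finite ?L" using finite_lower V by simp
  have ne: "?L \<noteq> {}" using V(4) by auto
  have "Min ?L \<noteq> Max ?L"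
  proof
    assume "Min ?L = Max ?L"
    then have "?L \<subseteq> {Min ?L}" using fin by (metis Max_ge Min_le antisym singletonI subsetI)
    then show False using card_mono[of "{Min ?L}" ?L] V(4) by simp
  qed
  then have "card {(Min ?L, s - Min ?L), (Max ?L, s - Max ?L)} = 2"
    by simp
  moreover have "{(Min ?L, s - Min ?L), (Max ?L, s - Max ?L)} \<subseteq> T \<inter> rungs s 0"
    using outer_rung[OF V(1,2) ne] inner_rung[OF V(1,2) ne V(3)] Min_in[OF fin ne] Max_in[OF fin ne]
    by (auto simp: rungs_def lower_def)
  moreover have "finite (T \<inter> rungs s 0)"
    using V finite_tri by (auto simp: symmetric_def)
  ultimately show ?thesis using card_mono by metis
qed

lemma eq_singleton_iff_card: "p \<in> A \<Longrightarrow> A = {p} \<longleftrightarrow> card A = Suc 0"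
  by (auto simp: card_1_singleton_iff)

text \<open>Cut along the second rung. The outer piece then has exactly two rungs, the outermost one
  and the cut. The inner piece loses the outermost rung and keeps the cut as its own, hence
  \<open>Q (n - 1)\<close>.\<close>

lemma ladders_rec:
  assumes V: "symmetric s V" "lower s V \<noteq> {}"
  shows "ladders s V (\<lambda>n. 2 \<le> n \<and> Q (n - 1))
    = (\<Sum>a\<in>lower s V - {Min (lower s V)}.
        ladders s (V - {a<..<s - a}) (\<lambda>n. n = 2) * ladders s (V \<inter> {a..s - a}) Q)"
proof -
  define m where "m = Min (lower s V)"
  have m: "m \<in> lower s V" and m_le: "\<And>x. x \<in> lower s V \<Longrightarrow> m \<le> x"
    using finite_lower V by (auto simp: m_def)
  have finV: "finite V" using V by (simp add: symmetric_def)
  \<comment> \<open>This is applied both to \<open>V\<close> and to the outer piece; each contains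
    the outermost pair, so skipping it lowers the count by one.\<close>
  have out: "T \<inter> rungs s 0 = insert (m, s - m) (T \<inter> rungs s (Suc m))
      \<and> card (T \<inter> rungs s 0) = Suc (card (T \<inter> rungs s (Suc m)))"
    if T: "T \<in> tris W" "W \<subseteq> V" "symmetric s W" "m \<in> W" for T W
  proof -
    have mW: "m \<in> lower s W" using m that by (auto simp: lower_def)
    have W: "lower s W \<subseteq> lower s V" using that by (auto simp: lower_def)
    have "Min (lower s W) = m"
      by (rule Min_eqI) (use mW W m_le finite_lower[OF T(3)] in auto)
    then have "(m, s - m) \<in> T"
      using outer_rung[OF T(3,1)] mW by auto
    moreover have "m \<le> a" if "(a, b) \<in> T" "a + b = s" for a b
      using that subsetD[OF tris_subset[OF T(1)], of "(a, b)"] T(2) m_le[of a] by (auto simp: chords_def lower_def)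
    ultimately have eq: "T \<inter> rungs s 0 = insert (m, s - m) (T \<inter> rungs s (Suc m))"
      using m by (fastforce simp: rungs_def lower_def)
    have "finite (T \<inter> rungs s (Suc m))"
      using T finite_tri by (auto simp: symmetric_def)
    moreover have "(m, s - m) \<notin> T \<inter> rungs s (Suc m)"
      by (simp add: rungs_def)
    ultimately have "card (T \<inter> rungs s 0) = Suc (card (T \<inter> rungs s (Suc m)))"
      unfolding eq by (rule card_insert_disjoint)
    with eq show ?thesis by blast
  qed
  have I: "{a \<in> V. Suc m \<le> a \<and> s - a \<in> V \<and> 2 * a < s} = lower s V - {m}"
    using V(1) m m_le by (fastforce simp: symmetric_def lower_def)
  have "{T \<in> tris V. 2 \<le> card (T \<inter> rungs s 0) \<and> Q (card (T \<inter> rungs s 0) - 1)}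
      = {T \<in> tris V. T \<inter> rungs s (Suc m) \<noteq> {} \<and> Q (card (T \<inter> rungs s (Suc m)))}"
  proof (rule Collect_cong, rule conj_cong[OF refl])
    fix T assume T: "T \<in> tris V"
    have "finite (T \<inter> rungs s (Suc m))" using T finite_tri finV by auto
    then show "2 \<le> card (T \<inter> rungs s 0) \<and> Q (card (T \<inter> rungs s 0) - 1)
      \<longleftrightarrow> T \<inter> rungs s (Suc m) \<noteq> {} \<and> Q (card (T \<inter> rungs s (Suc m)))"
      using out[OF T _ V(1)] m by (auto simp: lower_def Suc_le_eq card_gt_0_iff)
  qed
  then have "ladders s V (\<lambda>n. 2 \<le> n \<and> Q (n - 1))
      = int (card {T \<in> tris V. T \<inter> rungs s (Suc m) \<noteq> {} \<and> Q (card (T \<inter> rungs s (Suc m)))})"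
    by (simp add: ladders_def)
  also have "\<dots> = (\<Sum>a\<in>lower s V - {m}.
      int (card {T \<in> tris (V - {a<..<s - a}). T \<inter> rungs s (Suc m) = {(a, s - a)}})
      * ladders s (V \<inter> {a..s - a}) Q)"
    unfolding first_rung[OF finV] I by (simp add: ladders_def)
  also have "\<dots> = (\<Sum>a\<in>lower s V - {m}.
        ladders s (V - {a<..<s - a}) (\<lambda>n. n = 2) * ladders s (V \<inter> {a..s - a}) Q)"
  proof (rule sum.cong[OF refl])
    fix a assume "a \<in> lower s V - {m}"
    then have a: "a \<in> lower s V" "m < a" using m_le[of a] by auto
    let ?W = "V - {a<..<s - a}"
    have "{T \<in> tris ?W. T \<inter> rungs s (Suc m) = {(a, s - a)}} = {T \<in> tris ?W. card (T \<inter> rungs s 0) = 2}"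
    proof (rule Collect_cong, rule conj_cong[OF refl])
      fix T assume T: "T \<in> tris ?W"
      have "(a, s - a) \<in> T"
        using side_in_tri[OF T, of a "s - a"] a V(1) by (auto simp: symmetric_def lower_def)
      then have "(a, s - a) \<in> T \<inter> rungs s (Suc m)"
        using a by (auto simp: rungs_def lower_def)
      moreover have "card (T \<inter> rungs s 0) = Suc (card (T \<inter> rungs s (Suc m)))"
        using out[OF T _ symmetric_outer(1)[OF V(1) a(1)]] m a by (auto simp: lower_def)
      ultimately show "T \<inter> rungs s (Suc m) = {(a, s - a)} \<longleftrightarrow> card (T \<inter> rungs s 0) = 2"
        by (simp add: eq_singleton_iff_card)
    qed
    then show "int (card {T \<in> tris ?W. T \<inter> rungs s (Suc m) = {(a, s - a)}}) * ladders s (V \<inter> {a..s - a}) Q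
      = ladders s ?W (\<lambda>n. n = 2) * ladders s (V \<inter> {a..s - a}) Q"
      by (simp add: ladders_def)
  qed
  finally show ?thesis unfolding m_def .
qed

text \<open>Rank 0 is that of \<open>Min L\<close>, the end of the outermost rung, which cannot be
  the second one; the range therefore starts at 1.\<close>

lemma sum_rank:
  fixes L :: "nat set"
  assumes L: "finite L" "L \<noteq> {}"
    and eq: "\<And>a. a \<in> L \<Longrightarrow> 1 \<le> card {x \<in> L. x < a} \<Longrightarrow> card {x \<in> L. x < a} < card L
      \<Longrightarrow> F a = h (card {x \<in> L. x < a})"
  shows "(\<Sum>a\<in>L - {Min L}. F a) = (\<Sum>r\<in>{1..<card L}. h r)"
proof -
  let ?r = "\<lambda>a. card {x \<in> L. x < a}"
  have bij: "bij_betw ?r L {..<card L}" by (rule bij_rank[OF L(1)])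
  have min: "Min L \<in> L" using L by simp
  have r0: "?r (Min L) = 0" using L by (auto simp: not_less)
  have "bij_betw ?r (L - {Min L}) ({..<card L} - {?r (Min L)})"
    using min bij_betwE[OF bij] by (intro bij_betw_DiffI[OF bij]) simp_all
  moreover have "{..<card L} - {?r (Min L)} = {1..<card L}"
    unfolding r0 by auto
  ultimately have bij': "bij_betw ?r (L - {Min L}) {1..<card L}" by simp
  have "(\<Sum>a\<in>L - {Min L}. F a) = (\<Sum>a\<in>L - {Min L}. h (?r a))"
  proof (rule sum.cong[OF refl])
    fix a assume a: "a \<in> L - {Min L}"
    then have "?r a \<in> {1..<card L}" using bij_betwE[OF bij'] by blast
    then show "F a = h (?r a)" using a eq by auto
  qed
  also have "\<dots> = (\<Sum>r\<in>{1..<card L}. h r)"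
    by (rule sum.reindex_bij_betw[OF bij'])
  finally show ?thesis .
qed

section \<open>Triangulations of a symmetric polygon by number of rungs\<close>

lemma ladders_True:
  assumes "symmetric s V" "2 \<le> card V"
  shows "ladders s V (\<lambda>_. True) = catalan (card V - 2)"
  using card_tris[of cat V] assms by (simp add: ladders_def catalan_eq cat.simps(2) symmetric_def)

text \<open>The case distinction need only be valid for counts that occur, so bounds on the number
  of rungs can be used.\<close>

lemma ladders_add:
  assumes "symmetric s V"
    and "\<And>T. T \<in> tris V \<Longrightarrow>
      (P (card (T \<inter> rungs s 0)) \<or> Q (card (T \<inter> rungs s 0))) = R (card (T \<inter> rungs s 0))
      \<and> \<not> (P (card (T \<inter> rungs s 0)) \<and> Q (card (T \<inter> rungs s 0)))"
  shows "ladders s V R = ladders s V P + ladders s V Q"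
proof -
  have fin: "finite (tris V)" using assms(1) finite_tris by (simp add: symmetric_def)
  have "{T \<in> tris V. R (card (T \<inter> rungs s 0))}
      = {T \<in> tris V. P (card (T \<inter> rungs s 0))} \<union> {T \<in> tris V. Q (card (T \<inter> rungs s 0))}"
    using assms(2) by blast
  moreover have "card \<dots> = card {T \<in> tris V. P (card (T \<inter> rungs s 0))}
      + card {T \<in> tris V. Q (card (T \<inter> rungs s 0))}"
    by (rule card_Un_disjoint) (use fin assms(2) in auto)
  ultimately show ?thesis by (simp add: ladders_def)
qed

lemma ladders_cong:
  assumes "\<And>T. T \<in> tris V \<Longrightarrow> P (card (T \<inter> rungs s 0)) = Q (card (T \<inter> rungs s 0))"
  shows "ladders s V P = ladders s V Q"
  unfolding ladders_def using assms by (metis (mono_tags, lifting) Collect_cong)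

text \<open>This is H = 2 B. Sorting all triangulations by the second rung gives a recurrence for
  the Catalan number at 2m in which, by induction, only the newest coefficient of H is unknown. The
  identity \<open>evens_odds\<close> has the same shape and fixes it.\<close>

lemma ladders_even_2:
  assumes "symmetric s V" "center s V = {}" "card (lower s V) = Suc m" "1 \<le> m"
  shows "ladders s V (\<lambda>n. n = 2) = 2 * codd m"
  using assms
proof (induction m arbitrary: V rule: less_induct)
  case (less m)
  note V = less.prems
  have ne: "lower s V \<noteq> {}" using V(3) by auto
  have cardV: "card V = 2 * m + 2" using card_symmetric[OF V(1)] V by simp
  have "catalan (2 * m) = ladders s V (\<lambda>_. True)"
    using ladders_True[OF V(1)] cardV by simp
  also have "\<dots> = ladders s V (\<lambda>n. n = 2) + ladders s V (\<lambda>n. 2 \<le> n \<and> 2 \<le> n - 1)"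
    by (rule ladders_add[OF V(1)]) (use card_rungs_ge_2[OF V(1) _ V(2)] V in force)
  \<comment> \<open>At least three rungs are required here. For \<open>r = m\<close> the second rung
    is the innermost one, the inner piece is a single chord, and the summand vanishes.\<close>
  also have "ladders s V (\<lambda>n. 2 \<le> n \<and> 2 \<le> n - 1)
      = (\<Sum>r\<in>{1..<Suc m}. if r = m then 0 else 2 * codd r * catalan (2 * (m - r)))"
    unfolding ladders_rec[OF V(1) ne] V(3)[symmetric]
  proof (rule sum_rank[OF finite_lower[OF V(1)] ne])
    fix a
    let ?r = "card {x \<in> lower s V. x < a}"
    let ?O = "V - {a<..<s - a}" and ?I = "V \<inter> {a..s - a}"
    assume a: "a \<in> lower s V" "1 \<le> ?r" "?r < card (lower s V)"
    note O = symmetric_outer[OF V(1) a(1)]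
    note I = symmetric_inner[OF V(1) a(1)]
    have cI: "card (lower s ?I) = Suc (m - ?r)" using I(3) a V(3) by simp
    show "ladders s ?O (\<lambda>n. n = 2) * ladders s ?I (\<lambda>n. 2 \<le> n)
      = (if ?r = m then 0 else 2 * codd ?r * catalan (2 * (m - ?r)))"
    proof (cases "?r = m")
      case True
      then have "card (T \<inter> rungs s 0) \<le> 1" if "T \<in> tris ?I" for T
        using card_rungs_le[OF I(1) that] cI by simp
      then have "ladders s ?I (\<lambda>n. 2 \<le> n) = ladders s ?I (\<lambda>n. False)"
        by (intro ladders_cong) fastforce
      then show ?thesis using True by (simp add: ladders_def)
    next
      case False
      then have r: "?r < m" using a V(3) by simp
      have "ladders s ?I (\<lambda>n. 2 \<le> n) = ladders s ?I (\<lambda>n. True)"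
        by (intro ladders_cong) (use card_rungs_ge_2[OF I(1)] I(2) V(2) cI r in simp)
      also have "\<dots> = catalan (2 * (m - ?r))"
        using ladders_True[OF I(1)] card_symmetric[OF I(1)] I(2) V(2) cI by simp
      finally show ?thesis
        using less.IH[OF r O(1,2,3) a(2)] False by simp
    qed
  qed
  also have "\<dots> = (\<Sum>r\<in>{1..<m}. 2 * codd r * catalan (2 * (m - r)))"
    using V(4) by (simp add: atLeastLessThanSuc sum.If_cases) (rule sum.cong; force)
  finally have 1: "catalan (2 * m) = ladders s V (\<lambda>n. n = 2) + (\<Sum>r\<in>{1..<m}. 2 * codd r * catalan (2 * (m - r)))" .
  have "catalan (2 * m) = fps_nth (1 + 2 * (odds * evens)) m"
    using evens_odds by (simp add: evens_def flip: evens_odds)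
  also have "\<dots> = 2 * (\<Sum>r\<in>{1..m}. codd r * catalan (2 * (m - r)))"
    using V(4) by (simp add: numeral_fps_const fps_mult_nth_no_const[of odds] odds_nth evens_def)
  \<comment> \<open>The summand at \<open>m\<close> carries \<open>catalan 0\<close>, that is 1; it
    is the value sought.\<close>
  also have "\<dots> = (\<Sum>r\<in>{1..<m}. 2 * codd r * catalan (2 * (m - r))) + 2 * codd m"
  proof -
    have "{1..m} = insert m {1..<m}" using V(4) by auto
    then show ?thesis by (simp add: sum_distrib_left mult.assoc catalan_eq)
  qed
  finally show ?case using 1 by simp
qed

text \<open>Between \<open>Suc j\<close> rungs there are \<open>j\<close> trapezoids, each
  contributing the factor \<open>2 * odds\<close>. A single rung occurs only for the two-vertex
  polygon, the constant term 1.\<close>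

lemma ladders_even:
  assumes "symmetric s V" "center s V = {}" "card (lower s V) = Suc m"
  shows "ladders s V (\<lambda>n. n = Suc j) = fps_nth ((2 * odds) ^ j) m"
  using assms
proof (induction j arbitrary: V m)
  case 0
  note V = 0
  have ne: "lower s V \<noteq> {}" using V(3) by auto
  show ?case
  proof (cases "m = 0")
    case True
    have "ladders s V (\<lambda>n. n = Suc 0) = ladders s V (\<lambda>n. True)"
    proof (rule ladders_cong)
      fix T assume "T \<in> tris V"
      then show "(card (T \<inter> rungs s 0) = Suc 0) = True"
        using card_rungs_ge_1[OF V(1) _ ne] card_rungs_le[OF V(1)] V(3) True by (metis One_nat_def le_antisym)
    qed
    also have "\<dots> = 1"
      using ladders_True[OF V(1)] card_symmetric[OF V(1)] V True by (simp add: catalan_eq)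
    finally show ?thesis using True by simp
  next
    case False
    have "ladders s V (\<lambda>n. n = Suc 0) = ladders s V (\<lambda>n. False)"
    proof (rule ladders_cong)
      fix T assume "T \<in> tris V"
      then show "(card (T \<inter> rungs s 0) = Suc 0) = False"
        using card_rungs_ge_2[OF V(1) _ V(2)] V(3) False by force
    qed
    then show ?thesis using False by (simp add: ladders_def)
  qed
next
  case (Suc j)
  note V = Suc.prems
  have ne: "lower s V \<noteq> {}" using V(3) by auto
  have "ladders s V (\<lambda>n. n = Suc (Suc j)) = ladders s V (\<lambda>n. 2 \<le> n \<and> n - 1 = Suc j)"
    by (rule ladders_cong) auto
  also have "\<dots> = (\<Sum>r\<in>{1..<Suc m}. 2 * codd r * fps_nth ((2 * odds) ^ j) (m - r))"
    unfolding ladders_rec[OF V(1) ne, of "\<lambda>n. n = Suc j"] V(3)[symmetric]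
  proof (rule sum_rank[OF finite_lower[OF V(1)] ne])
    fix a
    let ?r = "card {x \<in> lower s V. x < a}"
    assume a: "a \<in> lower s V" "1 \<le> ?r" "?r < card (lower s V)"
    note O = symmetric_outer[OF V(1) a(1)]
    note I = symmetric_inner[OF V(1) a(1)]
    show "ladders s (V - {a<..<s - a}) (\<lambda>n. n = 2) * ladders s (V \<inter> {a..s - a}) (\<lambda>n. n = Suc j)
      = 2 * codd ?r * fps_nth ((2 * odds) ^ j) (m - ?r)"
      using ladders_even_2[OF O a(2)] Suc.IH[OF I(1), of "m - ?r"] I V a by simp
  qed
  also have "\<dots> = fps_nth (2 * odds * (2 * odds) ^ j) m"
    unfolding atLeastLessThanSuc_atLeastAtMost
    by (subst fps_mult_nth_no_const) (auto simp: odds_nth numeral_fps_const intro!: sum.cong)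
  finally show ?case by simp
qed

text \<open>As before, with a cap around the central vertex behind the last rung. For one rung, the
  triangulations with a second rung are subtracted from the total \<open>codd m\<close>, leaving the
  coefficient of B - 2 B^2.\<close>

lemma ladders_odd:
  assumes "symmetric s V" "card (center s V) = 1" "card (lower s V) = m" "1 \<le> m"
  shows "ladders s V (\<lambda>n. n = Suc j) = fps_nth ((2 * odds) ^ j * caps) m"
  using assms
proof (induction j arbitrary: V m)
  case 0
  note V = 0
  have ne: "lower s V \<noteq> {}" using V(3,4) by auto
  have cardV: "card V = 2 * m + 1" using card_symmetric[OF V(1)] V by simp
  have "codd m = ladders s V (\<lambda>_. True)"
    using ladders_True[OF V(1)] cardV V(4) by (simp add: codd_def)
  also have "\<dots> = ladders s V (\<lambda>n. n = Suc 0) + ladders s V (\<lambda>n. 2 \<le> n \<and> True)"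
    by (rule ladders_add[OF V(1)]) (use card_rungs_ge_1[OF V(1) _ ne] in force)
  also have "ladders s V (\<lambda>n. 2 \<le> n \<and> True) = (\<Sum>r\<in>{1..<m}. 2 * codd r * codd (m - r))"
    unfolding ladders_rec[OF V(1) ne, of "\<lambda>_. True"] unfolding V(3)[symmetric]
  proof (rule sum_rank[OF finite_lower[OF V(1)] ne])
    fix a
    let ?r = "card {x \<in> lower s V. x < a}"
    assume a: "a \<in> lower s V" "1 \<le> ?r" "?r < card (lower s V)"
    note O = symmetric_outer[OF V(1) a(1)]
    note I = symmetric_inner[OF V(1) a(1)]
    have "ladders s (V \<inter> {a..s - a}) (\<lambda>n. True) = codd (card (lower s V) - ?r)"
      using ladders_True[OF I(1)] card_symmetric[OF I(1)] I V a by (simp add: codd_def)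
    then show "ladders s (V - {a<..<s - a}) (\<lambda>n. n = 2) * ladders s (V \<inter> {a..s - a}) (\<lambda>n. True)
      = 2 * codd ?r * codd (card (lower s V) - ?r)"
      using ladders_even_2[OF O a(2)] by simp
  qed
  also have "\<dots> = 2 * fps_nth (odds * odds) m"
  proof -
    have "{1..m} = insert m {1..<m}" using V(4) by auto
    then show ?thesis
      by (simp add: fps_mult_nth_no_const odds_nth sum_distrib_left mult.assoc)
  qed
  finally show ?case
    using V(4) by (simp add: caps_def numeral_fps_const odds_nth)
next
  case (Suc j)
  note V = Suc.prems
  have ne: "lower s V \<noteq> {}" using V(3,4) by auto
  have "ladders s V (\<lambda>n. n = Suc (Suc j)) = ladders s V (\<lambda>n. 2 \<le> n \<and> n - 1 = Suc j)"
    by (rule ladders_cong) auto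
  also have "\<dots> = (\<Sum>r\<in>{1..<m}. 2 * codd r * fps_nth ((2 * odds) ^ j * caps) (m - r))"
    unfolding ladders_rec[OF V(1) ne, of "\<lambda>n. n = Suc j"] unfolding V(3)[symmetric]
  proof (rule sum_rank[OF finite_lower[OF V(1)] ne])
    fix a
    let ?r = "card {x \<in> lower s V. x < a}"
    assume a: "a \<in> lower s V" "1 \<le> ?r" "?r < card (lower s V)"
    note O = symmetric_outer[OF V(1) a(1)]
    note I = symmetric_inner[OF V(1) a(1)]
    show "ladders s (V - {a<..<s - a}) (\<lambda>n. n = 2) * ladders s (V \<inter> {a..s - a}) (\<lambda>n. n = Suc j)
      = 2 * codd ?r * fps_nth ((2 * odds) ^ j * caps) (card (lower s V) - ?r)"
      using ladders_even_2[OF O a(2)] Suc.IH[OF I(1), of "m - ?r"] I V a by simp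
  qed
  also have "\<dots> = fps_nth (2 * odds * ((2 * odds) ^ j * caps)) m"
  proof -
    have "{1..m} = insert m {1..<m}" using V(4) by auto
    moreover have "fps_nth ((2 * odds) ^ j * caps) 0 = 0"
      by (simp add: fps_mult_nth caps_nth)
    ultimately show ?thesis
      by (subst fps_mult_nth_no_const) (auto simp: odds_nth numeral_fps_const intro!: sum.cong)
  qed
  finally show ?case by (simp add: mult.assoc)
qed

section \<open>Relabelling vertices\<close>

text \<open>Membership in \<open>tris\<close> is expressed by crossings alone, so a bijection of
  chords that preserves them carries it over.\<close>

lemma image_tris:
  assumes bij: "bij_betw \<sigma> (chords V) (chords W)"
    and cr: "\<And>p q. p \<in> chords V \<Longrightarrow> q \<in> chords V \<Longrightarrow> crosses (\<sigma> p) (\<sigma> q) = crosses p q"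
    and T: "T \<in> tris V"
  shows "\<sigma> ` T \<in> tris W"
proof (rule trisI)
  fix q
  have sub: "T \<subseteq> chords V" by (rule tris_subset[OF T])
  show "q \<in> \<sigma> ` T \<longleftrightarrow> q \<in> chords W \<and> (\<forall>p\<in>\<sigma> ` T. \<not> crosses p q)"
  proof
    assume "q \<in> \<sigma> ` T"
    then obtain p where p: "p \<in> T" "q = \<sigma> p" by blast
    then have "\<not> crosses r p" if "r \<in> T" for r using trisD[OF T] that by blast
    then have "\<not> crosses (\<sigma> r) (\<sigma> p)" if "r \<in> T" for r using cr p sub that by blast
    moreover have "\<sigma> p \<in> chords W" using bij_betwE[OF bij] p sub by blast
    ultimately show "q \<in> chords W \<and> (\<forall>p\<in>\<sigma> ` T. \<not> crosses p q)"
      using p by blast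
  next
    assume q: "q \<in> chords W \<and> (\<forall>p\<in>\<sigma> ` T. \<not> crosses p q)"
    then obtain p where p: "p \<in> chords V" "q = \<sigma> p"
      using bij_betw_imp_surj_on[OF bij] by blast
    then have "\<forall>r\<in>T. \<not> crosses r p" using q cr sub by blast
    then show "q \<in> \<sigma> ` T" using trisD[OF T, of p] p by blast
  qed
qed

lemma card_tris_transfer:
  assumes bij: "bij_betw \<sigma> (chords V) (chords W)"
    and cr: "\<And>p q. p \<in> chords V \<Longrightarrow> q \<in> chords V \<Longrightarrow> crosses (\<sigma> p) (\<sigma> q) = crosses p q"
    and R: "\<And>p. p \<in> chords V \<Longrightarrow> \<sigma> p \<in> R' \<longleftrightarrow> p \<in> R"
  shows "card {T \<in> tris V. Q (card (T \<inter> R))} = card {T \<in> tris W. Q (card (T \<inter> R'))}"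
proof -
  define \<tau> where "\<tau> = inv_into (chords V) \<sigma>"
  have bij': "bij_betw \<tau> (chords W) (chords V)"
    unfolding \<tau>_def by (rule bij_betw_inv_into[OF bij])
  have \<tau>\<sigma>: "\<tau> (\<sigma> p) = p" if "p \<in> chords V" for p
    unfolding \<tau>_def using bij that by (rule bij_betw_inv_into_left)
  have \<sigma>\<tau>: "\<sigma> (\<tau> p) = p" if "p \<in> chords W" for p
    unfolding \<tau>_def using bij that by (rule bij_betw_inv_into_right)
  have \<tau>: "\<tau> p \<in> chords V" if "p \<in> chords W" for p
    using bij_betwE[OF bij'] that by blast
  have cr': "crosses (\<tau> p) (\<tau> q) = crosses p q" if "p \<in> chords W" "q \<in> chords W" for p q
    using cr[OF \<tau> \<tau>, OF that] \<sigma>\<tau> that by simp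
  have inv1: "\<tau> ` \<sigma> ` T = T" if "T \<in> tris V" for T
    using tris_subset[OF that] \<tau>\<sigma> by (force simp: image_image)
  have inv2: "\<sigma> ` \<tau> ` T = T" if "T \<in> tris W" for T
    using tris_subset[OF that] \<sigma>\<tau> by (force simp: image_image)
  have card: "card (\<sigma> ` T \<inter> R') = card (T \<inter> R)" if "T \<in> tris V" for T
  proof -
    have "\<sigma> ` T \<inter> R' = \<sigma> ` (T \<inter> R)"
      using tris_subset[OF that] R by blast
    moreover have "inj_on \<sigma> (T \<inter> R)"
      using bij tris_subset[OF that] by (auto simp: bij_betw_def intro: inj_on_subset)
    ultimately show ?thesis by (simp add: card_image)
  qed
  have "bij_betw (image \<sigma>) {T \<in> tris V. Q (card (T \<inter> R))} {T \<in> tris W. Q (card (T \<inter> R'))}"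
  proof (rule bij_betw_byWitness[where f' = "image \<tau>"])
    show "image \<sigma> ` {T \<in> tris V. Q (card (T \<inter> R))} \<subseteq> {T \<in> tris W. Q (card (T \<inter> R'))}"
      using card image_tris[OF bij cr] by auto
    show "image \<tau> ` {T \<in> tris W. Q (card (T \<inter> R'))} \<subseteq> {T \<in> tris V. Q (card (T \<inter> R))}"
    proof (rule image_subsetI)
      fix T assume T: "T \<in> {T \<in> tris W. Q (card (T \<inter> R'))}"
      then have "\<tau> ` T \<in> tris V" using image_tris[OF bij' cr'] by blast
      then show "\<tau> ` T \<in> {T \<in> tris V. Q (card (T \<inter> R))}"
        using T card[of "\<tau> ` T"] inv2[of T] by simp
    qed
  qed (use inv1 inv2 in auto)
  then show ?thesis by (rule bij_betw_same_card)
qed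

text \<open>Moving the vertices below \<open>c\<close> behind all others preserves the cyclic order when
  \<open>V\<close> fits into a window of length \<open>M\<close>.\<close>
definition rot :: "nat \<Rightarrow> nat \<Rightarrow> nat \<Rightarrow> nat" where
  "rot c M a = (if a < c then a + M else a)"

text \<open>Chords are increasing pairs; when only the smaller end moves behind, the two ends change
  places.\<close>

fun rot_chord :: "nat \<Rightarrow> nat \<Rightarrow> nat \<times> nat \<Rightarrow> nat \<times> nat" where
  "rot_chord c M (a, b) = (if a < c \<and> c \<le> b then (b, a + M) else (rot c M a, rot c M b))"

lemma rot_chord_bij:
  assumes win: "\<And>a b. a \<in> V \<Longrightarrow> b \<in> V \<Longrightarrow> b < a + M"
  shows "bij_betw (rot_chord c M) (chords V) (chords (rot c M ` V))"
  unfolding bij_betw_def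
proof
  show "inj_on (rot_chord c M) (chords V)"
  proof (rule inj_onI)
    fix p q assume pq: "p \<in> chords V" "q \<in> chords V" "rot_chord c M p = rot_chord c M q"
    obtain a b where p: "p = (a, b)" by (cases p)
    obtain d e where q: "q = (d, e)" by (cases q)
    have V: "a \<in> V" "b \<in> V" "d \<in> V" "e \<in> V" using pq by (auto simp: p q chords_iff)
    show "p = q"
      using pq win[OF V(1) V(2)] win[OF V(1) V(3)] win[OF V(1) V(4)] win[OF V(2) V(3)]
        win[OF V(2) V(4)] win[OF V(3) V(4)] win[OF V(3) V(1)] win[OF V(3) V(2)]
        win[OF V(4) V(1)] win[OF V(4) V(2)]
      by (auto simp: p q chords_iff rot_def split: if_splits)
  qed
  show "rot_chord c M ` chords V = chords (rot c M ` V)"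
  proof (intro equalityI subsetI)
    fix p assume "p \<in> rot_chord c M ` chords V"
    then obtain a b where ab: "(a, b) \<in> chords V" "p = rot_chord c M (a, b)" by auto
    then show "p \<in> chords (rot c M ` V)"
      using win[of a b] by (auto simp: chords_iff rot_def image_iff split: if_splits)
  next
    fix p assume "p \<in> chords (rot c M ` V)"
    then obtain a b where ab: "a \<in> V" "b \<in> V" "rot c M a < rot c M b" "p = (rot c M a, rot c M b)"
      by (cases p) (auto simp: chords_iff)
    have "p = rot_chord c M (min a b, max a b)" "(min a b, max a b) \<in> chords V"
      using ab win[of a b] win[of b a] by (auto simp: chords_iff rot_def min_def max_def split: if_splits)
    then show "p \<in> rot_chord c M ` chords V" by blast
  qed
qed

text \<open>Crossing means that the ends alternate cyclically, which a rotation respects. Each chord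
  lies above, across or below \<open>c\<close>; in the nine cases the window condition orders
  shifted against unshifted labels.\<close>

lemma crosses_rot_chord:
  assumes win: "\<And>a b. a \<in> V \<Longrightarrow> b \<in> V \<Longrightarrow> b < a + M"
    and pq: "p \<in> chords V" "q \<in> chords V"
  shows "crosses (rot_chord c M p) (rot_chord c M q) = crosses p q"
proof -
  obtain a b where p: "p = (a, b)" by (cases p)
  obtain d e where q: "q = (d, e)" by (cases q)
  have V: "a \<in> V" "b \<in> V" "d \<in> V" "e \<in> V" and ab: "a < b" and de: "d < e"
    using pq by (auto simp: p q chords_iff)
  have high: "rot_chord c M (x, y) = (x, y)" if "x < y" "c \<le> x" for x y
    using that by (simp add: rot_def)
  have mid: "rot_chord c M (x, y) = (y, x + M)" if "x < c" "c \<le> y" for x y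
    using that by simp
  have low: "rot_chord c M (x, y) = (x + M, y + M)" if "x < y" "y < c" for x y
    using that by (simp add: rot_def)
  consider "c \<le> a" | "a < c" "c \<le> b" | "b < c" by linarith
  then have "crosses (rot_chord c M (a, b)) (rot_chord c M (d, e)) \<longleftrightarrow> crosses (a, b) (d, e)"
  proof cases
    case 1
    consider "c \<le> d" | "d < c" "c \<le> e" | "e < c" by linarith
    then show ?thesis
    proof cases
      case 1
      then show ?thesis by (simp only: high ab de \<open>c \<le> a\<close>)
    next
      case 2
      then have "d < a" "b < d + M" using \<open>c \<le> a\<close> win V by auto
      then show ?thesis
        using ab unfolding high[OF ab \<open>c \<le> a\<close>] mid[OF 2] crosses_iff by auto
    next
      case 3
      then have "e < a" "b < d + M" using \<open>c \<le> a\<close> win V by auto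
      then show ?thesis
        using ab de unfolding high[OF ab \<open>c \<le> a\<close>] low[OF de 3] crosses_iff by auto
    qed
  next
    case a: 2
    consider "c \<le> d" | "d < c" "c \<le> e" | "e < c" by linarith
    then show ?thesis
    proof cases
      case 1
      then have "a < d" "e < a + M" using a win V by auto
      then show ?thesis
        using de unfolding high[OF de 1] mid[OF a] crosses_iff by auto
    next
      case 2
      then have "b < d + M" "e < a + M" "a < e" "d < b" using a win V by auto
      then show ?thesis
        unfolding mid[OF a] mid[OF 2] crosses_iff by auto
    next
      case 3
      then have "b < d + M" "e < b" using a win V by auto
      then show ?thesis
        using de unfolding mid[OF a] low[OF de 3] crosses_iff by auto
    qed
  next
    case b: 3
    consider "c \<le> d" | "d < c" "c \<le> e" | "e < c" by linarith
    then show ?thesis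
    proof cases
      case 1
      then have "b < d" "e < a + M" using b win V by auto
      then show ?thesis
        using ab de unfolding high[OF de 1] low[OF ab b] crosses_iff by auto
    next
      case 2
      then have "b < e" "e < a + M" using b win V by auto
      then show ?thesis
        using ab unfolding mid[OF 2] low[OF ab b] crosses_iff by auto
    next
      case 3
      then show ?thesis
        unfolding low[OF de 3] low[OF ab b] crosses_iff by simp
    qed
  qed
  then show ?thesis by (simp only: p q)
qed

lemma card_tris_rot:
  assumes win: "\<And>a b. a \<in> V \<Longrightarrow> b \<in> V \<Longrightarrow> b < a + M"
    and R: "\<And>a b. (a, b) \<in> chords V \<Longrightarrow> rot_chord c M (a, b) \<in> R' \<longleftrightarrow> (a, b) \<in> R"
  shows "card {T \<in> tris V. Q (card (T \<inter> R))} = card {T \<in> tris (rot c M ` V). Q (card (T \<inter> R'))}"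
proof (rule card_tris_transfer)
  show "bij_betw (rot_chord c M) (chords V) (chords (rot c M ` V))"
    using win by (rule rot_chord_bij)
  show "crosses (rot_chord c M p) (rot_chord c M q) = crosses p q" if "p \<in> chords V" "q \<in> chords V" for p q
    using win that by (rule crosses_rot_chord)
  show "rot_chord c M p \<in> R' \<longleftrightarrow> p \<in> R" if "p \<in> chords V" for p
    using R that by (cases p) blast
qed

section \<open>Counting by parallel diagonals\<close>

definition sides :: "nat \<Rightarrow> (nat \<times> nat) set" where
  "sides N = chords {..<N} - {p. is_diag N p}"

lemma finite_sides: "finite (sides N)"
  by (simp add: sides_def finite_chords)

lemma diag_chord: "is_diag N p \<Longrightarrow> p \<in> chords {..<N}"
  by (cases p) (auto simp: is_diag_def chords_iff)

lemma side_not_crosses: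
  assumes "p \<in> sides N" "q \<in> chords {..<N}"
  shows "\<not> crosses p q" "\<not> crosses q p"
  using assms by (cases p; cases q; auto simp: sides_def is_diag_def chords_iff crosses_iff)+

text \<open>Sides cross no chord, so adding all of them affects neither the absence of crossings nor
  maximality.\<close>

lemma triangulation_iff_tris:
  assumes "T \<inter> sides N = {}"
  shows "triangulation N T \<longleftrightarrow> T \<union> sides N \<in> tris {..<N}"
proof
  assume "triangulation N T"
  then have T: "T \<subseteq> {p. is_diag N p}" "\<forall>p\<in>T. \<forall>q\<in>T. \<not> crosses p q"
    "\<forall>q. is_diag N q \<and> q \<notin> T \<longrightarrow> (\<exists>p\<in>T. crosses p q)"
    by (auto simp: triangulation_def)
  show "T \<union> sides N \<in> tris {..<N}"
  proof (rule trisI)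
    fix q
    show "q \<in> T \<union> sides N \<longleftrightarrow> q \<in> chords {..<N} \<and> (\<forall>p\<in>T \<union> sides N. \<not> crosses p q)"
    proof
      assume q: "q \<in> T \<union> sides N"
      then have chord: "q \<in> chords {..<N}"
        using T(1) diag_chord unfolding sides_def by blast
      have "\<not> crosses p q" if "p \<in> T \<union> sides N" for p
      proof (cases "p \<in> T \<and> q \<in> T")
        case False
        have "p \<in> chords {..<N}" using that T(1) diag_chord unfolding sides_def by blast
        then show ?thesis
          using False q that chord side_not_crosses by blast
      qed (use T(2) in blast)
      with chord show "q \<in> chords {..<N} \<and> (\<forall>p\<in>T \<union> sides N. \<not> crosses p q)" by blast
    next
      assume "q \<in> chords {..<N} \<and> (\<forall>p\<in>T \<union> sides N. \<not> crosses p q)"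
      then show "q \<in> T \<union> sides N" using T(3) unfolding sides_def by blast
    qed
  qed
next
  assume T: "T \<union> sides N \<in> tris {..<N}"
  have diag: "is_diag N p" if "p \<in> T" for p
    using that assms tris_subset[OF T] unfolding sides_def by blast
  moreover have "\<not> crosses p q" if "p \<in> T" "q \<in> T" for p q
    using trisD[OF T] that by blast
  moreover have "\<exists>p\<in>T. crosses p q" if "is_diag N q" "q \<notin> T" for q
  proof -
    have "q \<notin> sides N" "q \<in> chords {..<N}" using that diag_chord unfolding sides_def by blast+
    then obtain p where "p \<in> T \<union> sides N" "crosses p q" using trisD[OF T, of q] \<open>q \<notin> T\<close> by blast
    then show ?thesis using side_not_crosses \<open>q \<in> chords {..<N}\<close> by blast
  qed
  ultimately show "triangulation N T" unfolding triangulation_def by blast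
qed

text \<open>The parallel sides belong to every element of \<open>tris\<close> and raise the count by
  a constant.\<close>

lemma f_eq_card_tris:
  "f x y N k = card {T \<in> tris {..<N}. card (T \<inter> Collect (parallel N x y))
      = k + card (sides N \<inter> Collect (parallel N x y))}"
proof -
  let ?P = "Collect (parallel N x y)"
  have disj: "T \<inter> sides N = {}" if "triangulation N T" for T
    using that by (auto simp: triangulation_def sides_def)
  have sub: "sides N \<subseteq> T" if T: "T \<in> tris {..<N}" for T
  proof
    fix q assume q: "q \<in> sides N"
    then have "q \<in> chords {..<N}" by (simp add: sides_def)
    then show "q \<in> T" using trisD[OF T, of q] side_not_crosses(2)[OF q] tris_subset[OF T] by blast
  qed
  have card: "card ((T \<union> sides N) \<inter> ?P) = card {p \<in> T. parallel N x y p} + card (sides N \<inter> ?P)"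
    if "T \<inter> sides N = {}" "T \<union> sides N \<in> tris {..<N}" for T
  proof -
    have "finite T" using finite_tri[OF _ that(2)] by simp
    then have "card ((T \<inter> ?P) \<union> (sides N \<inter> ?P)) = card (T \<inter> ?P) + card (sides N \<inter> ?P)"
      using that finite_sides by (intro card_Un_disjoint) auto
    then show ?thesis by (simp add: Int_Un_distrib2 Collect_conj_eq)
  qed
  have "bij_betw (\<lambda>T. T \<union> sides N) {T. triangulation N T \<and> card {p \<in> T. parallel N x y p} = k}
     {T \<in> tris {..<N}. card (T \<inter> ?P) = k + card (sides N \<inter> ?P)}"
  proof (rule bij_betw_byWitness[where f' = "\<lambda>T. T - sides N"])
    show "(\<lambda>T. T \<union> sides N) ` {T. triangulation N T \<and> card {p \<in> T. parallel N x y p} = k}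
      \<subseteq> {T \<in> tris {..<N}. card (T \<inter> ?P) = k + card (sides N \<inter> ?P)}"
    proof (rule image_subsetI)
      fix T assume T: "T \<in> {T. triangulation N T \<and> card {p \<in> T. parallel N x y p} = k}"
      then have dT: "T \<inter> sides N = {}" using disj by simp
      then have "T \<union> sides N \<in> tris {..<N}" using T triangulation_iff_tris by simp
      then show "T \<union> sides N \<in> {T \<in> tris {..<N}. card (T \<inter> ?P) = k + card (sides N \<inter> ?P)}"
        using T card[OF dT] by simp
    qed
    show "(\<lambda>T. T - sides N) ` {T \<in> tris {..<N}. card (T \<inter> ?P) = k + card (sides N \<inter> ?P)}
      \<subseteq> {T. triangulation N T \<and> card {p \<in> T. parallel N x y p} = k}"
    proof (rule image_subsetI)
      fix T assume T: "T \<in> {T \<in> tris {..<N}. card (T \<inter> ?P) = k + card (sides N \<inter> ?P)}"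
      then have "T - sides N \<union> sides N = T" using sub by blast
      then show "T - sides N \<in> {T. triangulation N T \<and> card {p \<in> T. parallel N x y p} = k}"
        using T triangulation_iff_tris[of "T - sides N" N] card[of "T - sides N"] by auto
    qed
  qed (use disj sub in blast)+
  then show ?thesis unfolding f_def by (rule bij_betw_same_card)
qed

section \<open>Parallel classes as rungs of a window\<close>

lemma mod_eq_small:
  fixes a N r :: nat
  assumes "r < N" "a < 2 * N"
  shows "a mod N = r mod N \<longleftrightarrow> a = r \<or> a = r + N"
  using assms by (cases "a < N") (auto simp: mod_if)

lemma rot_1_window: "1 \<le> N \<Longrightarrow> rot 1 N ` {..<N} = {1..N}"
proof
  assume "1 \<le> N"
  then show "rot 1 N ` {..<N} \<subseteq> {1..N}" by (auto simp: rot_def)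
  show "{1..N} \<subseteq> rot 1 N ` {..<N}"
  proof
    fix x assume "x \<in> {1..N}"
    then show "x \<in> rot 1 N ` {..<N}"
      by (intro image_eqI[of _ _ "if x = N then 0 else x"]) (auto simp: rot_def)
  qed
qed

text \<open>The possible label sums are 1 and \<open>N + 1\<close>. Renaming vertex 0 to
  \<open>N\<close> turns the only chord of sum 1, the side 01, into \<open>(1, N)\<close>, so one
  exact sum remains.\<close>

lemma f_01_eq_ladders:
  assumes "3 \<le> N"
  shows "int (f 0 1 N k) = ladders (N + 1) {1..N} (\<lambda>n. n = k + card (sides N \<inter> Collect (parallel N 0 1)))"
proof -
  let ?j = "k + card (sides N \<inter> Collect (parallel N 0 1))"
  have "card {T \<in> tris {..<N}. card (T \<inter> Collect (parallel N 0 1)) = ?j}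
    = card {T \<in> tris (rot 1 N ` {..<N}). card (T \<inter> rungs (N + 1) 0) = ?j}"
  proof (rule card_tris_rot)
    fix a b assume "(a, b) \<in> chords {..<N}"
    then have ab: "a < b" "b < N" by (auto simp: chords_iff)
    then have "(a + b) mod N = 1 mod N \<longleftrightarrow> a + b = 1 \<or> a + b = 1 + N"
      using assms by (intro mod_eq_small) auto
    then show "rot_chord 1 N (a, b) \<in> rungs (N + 1) 0 \<longleftrightarrow> (a, b) \<in> Collect (parallel N 0 1)"
      using ab by (auto simp: rungs_def parallel_def rot_def)
  qed auto
  then show ?thesis
    using assms unfolding f_eq_card_tris ladders_def by (subst (asm) rot_1_window) simp_all
qed

text \<open>The side opposite to 01 is parallel to it, so \<open>k\<close> diagonals mean
  \<open>k + 2\<close> rungs and \<open>k + 1\<close> trapezoids.\<close>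

lemma f_01_even:
  assumes "2 \<le> n"
  shows "int (f 0 1 (2 * n) k) = fps_nth ((2 * odds) ^ (k + 1)) (n - 1)"
proof -
  have "sides (2 * n) \<inter> Collect (parallel (2 * n) 0 1) = {(0, 1), (n, n + 1)}"
  proof (intro set_eqI iffI)
    fix p assume p: "p \<in> sides (2 * n) \<inter> Collect (parallel (2 * n) 0 1)"
    obtain a b where ab: "p = (a, b)" by (cases p)
    have "(a + b) mod (2 * n) = 1 mod (2 * n) \<longleftrightarrow> a + b = 1 \<or> a + b = 1 + 2 * n"
      using p assms by (intro mod_eq_small) (auto simp: ab sides_def chords_iff)
    then show "p \<in> {(0, 1), (n, n + 1)}"
      using p by (auto simp: ab sides_def chords_iff is_diag_def parallel_def)
  next
    fix p assume p: "p \<in> {(0, 1), (n, n + 1)}"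
    have "(n + (n + 1)) mod (2 * n) = 1 mod (2 * n)"
      using assms by (subst mod_eq_small) auto
    then show "p \<in> sides (2 * n) \<inter> Collect (parallel (2 * n) 0 1)"
      using assms p by (auto simp: sides_def chords_iff is_diag_def parallel_def)
  qed
  then have "int (f 0 1 (2 * n) k) = ladders (2 * n + 1) {1..2 * n} (\<lambda>m. m = Suc (k + 1))"
    using f_01_eq_ladders[of "2 * n" k] assms by simp
  also have "\<dots> = fps_nth ((2 * odds) ^ (k + 1)) (n - 1)"
  proof (rule ladders_even)
    have "lower (2 * n + 1) {1..2 * n} = {1..n}" by (auto simp: lower_def)
    then show "card (lower (2 * n + 1) {1..2 * n}) = Suc (n - 1)" using assms by simp
    show "center (2 * n + 1) {1..2 * n} = {}" by (auto simp: center_def) presburger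
  qed (auto simp: symmetric_def)
  finally show ?thesis .
qed

text \<open>Opposite to the side 01 lies the vertex \<open>n + 1\<close>, the tip of the cap; 01 is
  the only parallel side.\<close>

lemma f_01_odd:
  assumes "1 \<le> n"
  shows "int (f 0 1 (2 * n + 1) k) = fps_nth ((2 * odds) ^ k * caps) n"
proof -
  have "sides (2 * n + 1) \<inter> Collect (parallel (2 * n + 1) 0 1) = {(0, 1)}"
  proof (intro set_eqI iffI)
    fix p assume p: "p \<in> sides (2 * n + 1) \<inter> Collect (parallel (2 * n + 1) 0 1)"
    obtain a b where ab: "p = (a, b)" by (cases p)
    have "(a + b) mod (2 * n + 1) = 1 mod (2 * n + 1) \<longleftrightarrow> a + b = 1 \<or> a + b = 1 + (2 * n + 1)"
      using p assms by (intro mod_eq_small) (auto simp: ab sides_def chords_iff)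
    then have "a + b = 1 \<or> a + b = 2 * n + 2"
      using p by (auto simp: ab parallel_def)
    moreover have "a < b" "b - a < 2 \<or> a = 0 \<and> b = 2 * n" "b \<le> 2 * n"
      using p by (auto simp: ab sides_def chords_iff is_diag_def)
    ultimately have "a = 0 \<and> b = 1" by presburger
    then show "p \<in> {(0, 1)}" by (simp add: ab)
  next
    fix p :: "nat \<times> nat" assume "p \<in> {(0, 1)}"
    then show "p \<in> sides (2 * n + 1) \<inter> Collect (parallel (2 * n + 1) 0 1)"
      using assms by (auto simp: sides_def chords_iff is_diag_def parallel_def)
  qed
  then have "int (f 0 1 (2 * n + 1) k) = ladders (2 * n + 2) {1..2 * n + 1} (\<lambda>m. m = Suc k)"
    using f_01_eq_ladders[of "2 * n + 1" k] assms by simp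
  also have "\<dots> = fps_nth ((2 * odds) ^ k * caps) n"
  proof (rule ladders_odd)
    have "lower (2 * n + 2) {1..2 * n + 1} = {1..n}" by (auto simp: lower_def)
    then show "card (lower (2 * n + 2) {1..2 * n + 1}) = n" by simp
    have "center (2 * n + 2) {1..2 * n + 1} = {n + 1}" by (auto simp: center_def)
    then show "card (center (2 * n + 2) {1..2 * n + 1}) = 1" by simp
  qed (use assms in \<open>auto simp: symmetric_def\<close>)
  finally show ?thesis .
qed

text \<open>The tip \<open>2 * n + 1\<close> is the last label of \<open>W\<close>. Moving the
  labels up to \<open>a\<close> behind it by \<open>2 * n\<close> puts it in the middle, and the
  rungs then have sum \<open>4 * n + 2\<close>, twice the tip.\<close>

lemma tip_cap:
  assumes a: "2 \<le> a" "a \<le> n"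
  defines "s \<equiv> 2 * n + 2" and "W \<equiv> {2..2 * n + 1} - {a<..<2 * n + 2 - a}"
  shows "int (card {T \<in> tris W. T \<inter> rungs s 0 = {(a, s - a)}}) = fps_nth caps (a - 1)"
proof -
  have "{T \<in> tris W. T \<inter> rungs s 0 = {(a, s - a)}} = {T \<in> tris W. card (T \<inter> rungs s 0) = Suc 0}"
  proof (rule Collect_cong, rule conj_cong[OF refl])
    fix T assume T: "T \<in> tris W"
    have "(a, s - a) \<in> T"
      by (rule side_in_tri[OF T]) (use a in \<open>auto simp: W_def s_def\<close>)
    then have "(a, s - a) \<in> T \<inter> rungs s 0"
      using a by (auto simp: rungs_def s_def)
    then show "T \<inter> rungs s 0 = {(a, s - a)} \<longleftrightarrow> card (T \<inter> rungs s 0) = Suc 0"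
      by (rule eq_singleton_iff_card)
  qed
  then have "card {T \<in> tris W. T \<inter> rungs s 0 = {(a, s - a)}}
      = card {T \<in> tris W. card (T \<inter> rungs s 0) = Suc 0}" by simp
  also have "\<dots> = card {T \<in> tris (rot (a + 1) (2 * n) ` W). card (T \<inter> rungs (4 * n + 2) 0) = Suc 0}"
  proof (rule card_tris_rot)
    fix x y assume "(x, y) \<in> chords W"
    then show "rot_chord (a + 1) (2 * n) (x, y) \<in> rungs (4 * n + 2) 0 \<longleftrightarrow> (x, y) \<in> rungs s 0"
      using a by (auto simp: rungs_def rot_def W_def s_def chords_iff)
  qed (auto simp: W_def)
  also have "rot (a + 1) (2 * n) ` W = {2 * n + 2 - a..2 * n + a}"
  proof
    show "rot (a + 1) (2 * n) ` W \<subseteq> {2 * n + 2 - a..2 * n + a}"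
      using a by (auto simp: W_def rot_def)
    show "{2 * n + 2 - a..2 * n + a} \<subseteq> rot (a + 1) (2 * n) ` W"
    proof
      fix x assume "x \<in> {2 * n + 2 - a..2 * n + a}"
      then show "x \<in> rot (a + 1) (2 * n) ` W"
        using a by (intro image_eqI[of _ _ "if x \<le> 2 * n + 1 then x else x - 2 * n"])
          (auto simp: rot_def W_def)
    qed
  qed
  finally have "int (card {T \<in> tris W. T \<inter> rungs s 0 = {(a, s - a)}})
      = ladders (4 * n + 2) {2 * n + 2 - a..2 * n + a} (\<lambda>m. m = Suc 0)"
    by (simp add: ladders_def)
  also have "\<dots> = fps_nth ((2 * odds) ^ 0 * caps) (a - 1)"
  proof (rule ladders_odd)
    have "lower (4 * n + 2) {2 * n + 2 - a..2 * n + a} = {2 * n + 2 - a..2 * n}"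
      using a by (auto simp: lower_def)
    then show "card (lower (4 * n + 2) {2 * n + 2 - a..2 * n + a}) = a - 1"
      using a by simp
    have "center (4 * n + 2) {2 * n + 2 - a..2 * n + a} = {2 * n + 1}"
      using a by (auto simp: center_def)
    then show "card (center (4 * n + 2) {2 * n + 2 - a..2 * n + a}) = 1" by simp
  qed (use a in \<open>auto simp: symmetric_def\<close>)
  finally show ?thesis by simp
qed

lemma sum_shift:
  fixes F :: "nat \<Rightarrow> int"
  shows "(\<Sum>a\<in>{2..n}. F (a - 1) * G (n - (a - 1))) = (\<Sum>i\<in>{1..<n}. F i * G (n - i))"
  by (rule sum.reindex_bij_witness[where i = Suc and j = "\<lambda>a. a - 1"]) auto

text \<open>The outermost rung cuts off a cap around one tip. The rest is symmetric about the other
  tip and has \<open>Suc k\<close> rungs, hence \<open>k\<close> trapezoids and a second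
  cap.\<close>

lemma f_02_even:
  assumes n: "2 \<le> n"
  shows "int (f 0 2 (2 * n) (Suc k)) = fps_nth (caps * ((2 * odds) ^ k * caps)) n"
proof -
  let ?P = "Collect (parallel (2 * n) 0 2)"
  let ?W = "{2..2 * n + 1}"
  let ?s = "2 * n + 2"
  have mod2: "(a, b) \<in> ?P \<longleftrightarrow> a + b = 2 \<or> a + b = ?s" if "(a, b) \<in> chords {..<2 * n}" for a b
  proof -
    have "(a + b) mod (2 * n) = 2 mod (2 * n) \<longleftrightarrow> a + b = 2 \<or> a + b = 2 + 2 * n"
      using that n by (intro mod_eq_small) (auto simp: chords_iff)
    then show ?thesis
      unfolding mem_Collect_eq parallel_def prod.case by (simp only: add_0 add.commute)
  qed
  \<comment> \<open>Parity: every side has an odd label sum, while 2 and \<open>2 * n + 2\<close>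
    are even.\<close>
  have "(a, b) \<notin> sides (2 * n) \<inter> ?P" for a b
  proof
    assume ab: "(a, b) \<in> sides (2 * n) \<inter> ?P"
    then have "a < b" "b - a < 2 \<or> a = 0 \<and> b = 2 * n - 1" "b < 2 * n"
      by (auto simp: sides_def chords_iff is_diag_def)
    moreover have "a + b = 2 \<or> a + b = ?s"
      using mod2 ab by (auto simp: sides_def)
    ultimately show False using n by presburger
  qed
  then have "sides (2 * n) \<inter> ?P = {}" by auto
  then have "f 0 2 (2 * n) (Suc k) = card {T \<in> tris {..<2 * n}. card (T \<inter> ?P) = Suc k}"
    unfolding f_eq_card_tris by simp
  \<comment> \<open>Vertices 0 and 1 move behind the others. The only chord of sum 2,
    \<open>(0, 2)\<close>, becomes \<open>(2, 2 * n)\<close> with the common sum, and vertex 1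
    becomes the tip \<open>2 * n + 1\<close>.\<close>
  also have "\<dots> = card {T \<in> tris (rot 2 (2 * n) ` {..<2 * n}). card (T \<inter> rungs ?s 0) = Suc k}"
  proof (rule card_tris_rot)
    fix a b assume ab: "(a, b) \<in> chords {..<2 * n}"
    then show "rot_chord 2 (2 * n) (a, b) \<in> rungs ?s 0 \<longleftrightarrow> (a, b) \<in> ?P"
      using n unfolding mod2[OF ab] by (auto simp: rungs_def rot_def chords_iff)
  qed auto
  also have "rot 2 (2 * n) ` {..<2 * n} = ?W"
  proof
    show "rot 2 (2 * n) ` {..<2 * n} \<subseteq> ?W" using n by (auto simp: rot_def)
    show "?W \<subseteq> rot 2 (2 * n) ` {..<2 * n}"
    proof
      fix x assume "x \<in> ?W"
      then show "x \<in> rot 2 (2 * n) ` {..<2 * n}"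
        using n by (intro image_eqI[of _ _ "if x < 2 * n then x else x - 2 * n"]) (auto simp: rot_def)
    qed
  qed
  also have "{T \<in> tris ?W. card (T \<inter> rungs ?s 0) = Suc k}
      = {T \<in> tris ?W. T \<inter> rungs ?s 0 \<noteq> {} \<and> card (T \<inter> rungs ?s 0) = Suc k}"
    by force
  also have "card \<dots> = (\<Sum>a\<in>{2..n}. card {T \<in> tris (?W - {a<..<?s - a}). T \<inter> rungs ?s 0 = {(a, ?s - a)}}
        * card {T \<in> tris (?W \<inter> {a..?s - a}). card (T \<inter> rungs ?s 0) = Suc k})"
  proof -
    have "{a \<in> ?W. 0 \<le> a \<and> ?s - a \<in> ?W \<and> 2 * a < ?s} = {2..n}" by auto
    then show ?thesis
      using first_rung[of ?W ?s 0 "\<lambda>m. m = Suc k"] by simp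
  qed
  finally have "int (f 0 2 (2 * n) (Suc k))
      = (\<Sum>a\<in>{2..n}. int (card {T \<in> tris (?W - {a<..<?s - a}). T \<inter> rungs ?s 0 = {(a, ?s - a)}}
        * card {T \<in> tris (?W \<inter> {a..?s - a}). card (T \<inter> rungs ?s 0) = Suc k}))"
    by (simp only: of_nat_sum)
  also have "\<dots> = (\<Sum>a\<in>{2..n}. fps_nth caps (a - 1) * fps_nth ((2 * odds) ^ k * caps) (n - (a - 1)))"
  proof (rule sum.cong[OF refl])
    fix a assume "a \<in> {2..n}"
    then have a: "2 \<le> a" "a \<le> n" by auto
    have W: "?W \<inter> {a..?s - a} = {a..?s - a}" using a by auto
    have "int (card {T \<in> tris (?W \<inter> {a..?s - a}). card (T \<inter> rungs ?s 0) = Suc k})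
      = ladders ?s {a..?s - a} (\<lambda>m. m = Suc k)" unfolding W ladders_def ..
    also have "\<dots> = fps_nth ((2 * odds) ^ k * caps) (n - (a - 1))"
    proof (rule ladders_odd)
      have "lower ?s {a..?s - a} = {a..n}" using a by (auto simp: lower_def)
      then show "card (lower ?s {a..?s - a}) = n - (a - 1)" using a by simp
      have "center ?s {a..?s - a} = {n + 1}" using a by (auto simp: center_def)
      then show "card (center ?s {a..?s - a}) = 1" by simp
    qed (use a in \<open>auto simp: symmetric_def\<close>)
    finally show "int (card {T \<in> tris (?W - {a<..<?s - a}). T \<inter> rungs ?s 0 = {(a, ?s - a)}}
        * card {T \<in> tris (?W \<inter> {a..?s - a}). card (T \<inter> rungs ?s 0) = Suc k})
      = fps_nth caps (a - 1) * fps_nth ((2 * odds) ^ k * caps) (n - (a - 1))"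
      using tip_cap[OF a] by simp
  qed
  also have "\<dots> = (\<Sum>i\<in>{1..<n}. fps_nth caps i * fps_nth ((2 * odds) ^ k * caps) (n - i))"
    by (rule sum_shift[where F = "fps_nth caps" and G = "fps_nth ((2 * odds) ^ k * caps)"])
  also have "\<dots> = fps_nth (caps * ((2 * odds) ^ k * caps)) n"
  proof -
    \<comment> \<open>The summand at \<open>n\<close> vanishes: \<open>caps\<close> has no constant
      term, so neither has the second factor.\<close>
    have "{1..n} = insert n {1..<n}" using n by auto
    moreover have "fps_nth ((2 * odds) ^ k * caps) 0 = 0"
      by (simp add: fps_mult_nth caps_nth)
    ultimately show ?thesis
      by (subst fps_mult_nth_no_const) (simp_all add: caps_nth)
  qed
  finally show ?thesis .
qed

theorem theorem4:
  shows
  "(\<forall>n k. n \<ge> 2 \<longrightarrow> k \<ge> 1 \<longrightarrow>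
     int (f 0 1 (2*n) k) =
       (\<Sum>is\<in>comps (k+1) (n-1). 2^(k+1) * prod_list (map codd is)))
   \<and> (\<forall>n k. n \<ge> 2 \<longrightarrow> k \<ge> 1 \<longrightarrow>
     int (f 0 2 (2*n) k) =
       (\<Sum>is\<in>comps (k+1) n.
          2^(k-1) * g (is!0) * g (is!1) * prod_list (map codd (drop 2 is))))
   \<and> (\<forall>n k. n \<ge> 1 \<longrightarrow> k \<ge> 1 \<longrightarrow>
     int (f 0 1 (2*n+1) k) =
       (\<Sum>is\<in>comps (k+1) n.
          2^k * g (is!0) * prod_list (map codd (drop 1 is))))"
proof (intro conjI allI impI)
  fix n k :: nat assume "2 \<le> n"
  then show "int (f 0 1 (2*n) k) =
       (\<Sum>is\<in>comps (k+1) (n-1). 2^(k+1) * prod_list (map codd is))"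
    unfolding sum_comps_no_cap by (rule f_01_even)
next
  fix n k :: nat assume n: "2 \<le> n" and "1 \<le> k"
  then obtain l where k: "k = Suc l" by (cases k) auto
  show "int (f 0 2 (2*n) k) =
       (\<Sum>is\<in>comps (k+1) n.
          2^(k-1) * g (is!0) * g (is!1) * prod_list (map codd (drop 2 is)))"
    using f_02_even[OF n, of l] sum_comps_two_caps[of l n] by (simp add: k mult.commute)
next
  fix n k :: nat assume n: "1 \<le> n"
  show "int (f 0 1 (2*n+1) k) =
       (\<Sum>is\<in>comps (k+1) n.
          2^k * g (is!0) * prod_list (map codd (drop 1 is)))"
    using f_01_odd[OF n, of k] sum_comps_one_cap[of k n] by (simp add: mult.commute)
qed

end
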